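(* Let $X$ be an infinite-dimensional complex Banach space, $T\in\mathcal{B}(X)$ and $i\in\{1,2,3,4,5\}$. Then the following statements are equivalent: (i) $T\in S_i(X)$. (ii) There exist operators $S,R\in\mathcal{B}(X)$ such that $T=S+R$, $SR=RS=0$, $S\in S_i^1(X)$ and $R$ is nilpotent. (iii) There exist operators $S,R\in\mathcal{B}(X)$ such that $T=S+R$, $SR=RS=0$, $S\in S_i(X)$ and $R$ is nilpotent.
   Context: $\mathcal{B}(X)$ is the algebra of bounded linear operators on $X$; $\mathcal{N}(T)$, $\mathcal{R}(T)$ denote kernel and range; $\mathbb{N}_0=\{0,1,2,\dots\}$, $\mathbb{N}=\{1,2,\dots\}$; the infimum of the empty set is $\infty$. A subspace of a Banach space is topologically complemented if it is closed and has a closed algebraic complement. For $T\in\mathcal{B}(X)$: the ascent $a(T)$ (resp. descent $d(T)$) is the smallest $n\in\mathbb{N}_0$ with $\mathcal{N}(T^n)=\mathcal{N}(T^{n+1})$ (resp. $\mathcal{R}(T^n)=\mathcal{R}(T^{n+1})$). The essential ascent $a_e(T)$ (resp. essential descent $d_e(T)$) is the smallest $n\in\mathbb{N}_0$ with $\dim(\mathcal{N}(T)\cap\mathcal{R}(T^n))<\infty$ (resp. $\operatorname{codim}(\mathcal{R}(T)+\mathcal{N}(T^n))<\infty$). The degree of stable iteration is $\operatorname{dis}(T)=\inf\{n\in\mathbb{N}_0: m\ge n,\ m\in\mathbb{N}\Rightarrow \mathcal{N}(T)\cap\mathcal{R}(T^n)=\mathcal{N}(T)\cap\mathcal{R}(T^m)\}$.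 (All of these may be $\infty$.) $T$ is left Drazin invertible if $p:=a(T)<\infty$ and $\mathcal{R}(T)+\mathcal{N}(T^p)$ is topologically complemented; right Drazin invertible if $q:=d(T)<\infty$ and $\mathcal{N}(T)\cap\mathcal{R}(T^q)$ is topologically complemented; essentially left Drazin invertible if $a_e(T)<\infty$ and $\mathcal{R}(T)+\mathcal{N}(T^{\operatorname{dis}(T)})$ is topologically complemented; essentially right Drazin invertible if $d_e(T)<\infty$ and $\mathcal{N}(T)\cap\mathcal{R}(T^{\operatorname{dis}(T)})$ is topologically complemented. $(M,N)\in Red(T)$ means that $M,N$ are closed $T$-invariant subspaces of $X$ with $X=M\oplus N$; $T_M,T_N$ denote the restrictions of $T$ to $M$, $N$, viewed as operators on $M$, $N$. An operator is Kato if its range is closed and its kernel is contained in the range of each of its powers; relatively regular if its kernel and range are topologically complemented; Saphar if it is Kato and relatively regular. The degree of a nilpotent operator $Q$ is the smallest $d\in\mathbb{N}_0$ with $Q^d=0$. $T$ is of Saphar type (of degree $d$) if there is $(M,N)\in Red(T)$ with $T_M$ Saphar and $T_N$ nilpotent (of degree $d$); in that case $d=\operatorname{dis}(T)$. $S_1(X)$, $S_2(X)$, $S_3(X)$, $S_4(X)$, $S_5(X)$ denote, respectively, the sets of operators in $\mathcal{B}(X)$ that are: of Saphar type; left Drazin invertible; right Drazin invertible; essentially left Drazin invertible; essentially right Drazin invertible. $S_1^1(X)$, $S_2^1(X)$, $S_3^1(X)$, $S_4^1(X)$, $S_5^1(X)$ denote, respectively, the sets of: Saphar type operators of degree $\le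 1$; left Drazin invertible operators with ascent $\le 1$; right Drazin invertible operators with descent $\le 1$; essentially left Drazin invertible operators with essential ascent $\le 1$; essentially right Drazin invertible operators with essential descent $\le 1$. *)

theory Defs
  imports
    "HOL-Analysis.Analysis"
    "HOL-Library.Extended_Nat"
    "HOL-Library.Set_Algebras"
begin

class complex_normed_vector = real_normed_vector +
  fixes scaleC :: "complex \<Rightarrow> 'a \<Rightarrow> 'a" (infixr \<open>*\<^sub>C\<close> 75)
  assumes scaleC_add_right: "a *\<^sub>C (x + y) = a *\<^sub>C x + a *\<^sub>C y"
    and scaleC_add_left: "(a + b) *\<^sub>C x = a *\<^sub>C x + b *\<^sub>C x"
    and scaleC_scaleC: "a *\<^sub>C (b *\<^sub>C x) = (a * b) *\<^sub>C x"
    and scaleR_scaleC: "r *\<^sub>R x = complex_of_real r *\<^sub>C x"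
    and norm_scaleC: "norm (a *\<^sub>C x) = cmod a * norm x"

class complex_banach = complex_normed_vector + banach

global_interpretation complex_vector:
  vector_space "scaleC :: complex \<Rightarrow> 'a \<Rightarrow> 'a::complex_normed_vector"
  defines csubspace = complex_vector.subspace
    and cspan = complex_vector.span
proof
  fix a b :: complex and x y :: 'a
  show "a *\<^sub>C (x + y) = a *\<^sub>C x + a *\<^sub>C y" by (rule scaleC_add_right)
  show "(a + b) *\<^sub>C x = a *\<^sub>C x + b *\<^sub>C x" by (rule scaleC_add_left)
  show "a *\<^sub>C b *\<^sub>C x = (a * b) *\<^sub>C x" by (rule scaleC_scaleC)
  show "1 *\<^sub>C x = x" using scaleR_scaleC[of 1 x] by simp
qed

definition bounded_clinear :: "('a::complex_normed_vector \<Rightarrow> 'a) \<Rightarrow> bool" where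
  "bounded_clinear T \<longleftrightarrow> bounded_linear T \<and> (\<forall>c x. T (c *\<^sub>C x) = c *\<^sub>C T x)"

definition finite_cdim :: "'a::complex_normed_vector set \<Rightarrow> bool" where
  "finite_cdim V \<longleftrightarrow> (\<exists>B. finite B \<and> V \<subseteq> cspan B)"

definition algebraic_complement ::
    "'a::complex_normed_vector set \<Rightarrow> 'a set \<Rightarrow> 'a set \<Rightarrow> bool" where
  "algebraic_complement X V W \<longleftrightarrow>
     csubspace V \<and> csubspace W \<and> V \<inter> W = {0} \<and> V + W = X"

text \<open>The codimension of \<open>V\<close> is the dimension of any algebraic complement of \<open>V\<close>
  (all of them are isomorphic to the quotient by \<open>V\<close>).\<close>

definition finite_ccodim :: "'a::complex_normed_vector set \<Rightarrow> bool" where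
  "finite_ccodim V \<longleftrightarrow> (\<exists>W. algebraic_complement UNIV V W \<and> finite_cdim W)"

definition complemented_in :: "'a::complex_normed_vector set \<Rightarrow> 'a set \<Rightarrow> bool" where
  "complemented_in X V \<longleftrightarrow> closedin (top_of_set X) V \<and>
     (\<exists>W. closedin (top_of_set X) W \<and> algebraic_complement X V W)"

text \<open>In the definitions with suffix \<open>_on\<close>, the first argument \<open>M\<close> is a \<open>T\<close>-invariant closed
  subspace, and the notion defined concerns the restriction of \<open>T\<close> to \<open>M\<close>, viewed as an
  operator on \<open>M\<close>; the \<open>n\<close>-th power of that restriction is the restriction of \<open>T ^^ n\<close>,
  with range \<open>(T ^^ n) ` M\<close>. Operators on the whole space are the case \<open>M = UNIV\<close>.\<close>

definition ker_on :: "'a set \<Rightarrow> ('a \<Rightarrow> 'a::zero) \<Rightarrow> 'a set" where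
  "ker_on M T = {x \<in> M. T x = 0}"

abbreviation ker :: "('a \<Rightarrow> 'a::zero) \<Rightarrow> 'a set" where
  "ker T \<equiv> ker_on UNIV T"

definition kato_on :: "'a::complex_normed_vector set \<Rightarrow> ('a \<Rightarrow> 'a) \<Rightarrow> bool" where
  "kato_on M T \<longleftrightarrow> closedin (top_of_set M) (T ` M) \<and> (\<forall>n. ker_on M T \<subseteq> (T ^^ n) ` M)"

definition relatively_regular_on :: "'a::complex_normed_vector set \<Rightarrow> ('a \<Rightarrow> 'a) \<Rightarrow> bool" where
  "relatively_regular_on M T \<longleftrightarrow> complemented_in M (ker_on M T) \<and> complemented_in M (T ` M)"

definition saphar_on :: "'a::complex_normed_vector set \<Rightarrow> ('a \<Rightarrow> 'a) \<Rightarrow> bool" where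
  "saphar_on M T \<longleftrightarrow> kato_on M T \<and> relatively_regular_on M T"

definition nilpotent_on :: "'a set \<Rightarrow> ('a \<Rightarrow> 'a::zero) \<Rightarrow> bool" where
  "nilpotent_on M T \<longleftrightarrow> (\<exists>n. \<forall>x\<in>M. (T ^^ n) x = 0)"

definition nilpotency_degree_on :: "'a set \<Rightarrow> ('a \<Rightarrow> 'a::zero) \<Rightarrow> nat" where
  "nilpotency_degree_on M T = (LEAST n. \<forall>x\<in>M. (T ^^ n) x = 0)"

abbreviation nilpotent :: "('a \<Rightarrow> 'a::zero) \<Rightarrow> bool" where
  "nilpotent T \<equiv> nilpotent_on UNIV T"

definition Red :: "('a::complex_normed_vector \<Rightarrow> 'a) \<Rightarrow> ('a set \<times> 'a set) set" where
  "Red T = {(M, N). closed M \<and> closed N \<and> T ` M \<subseteq> M \<and> T ` N \<subseteq> N \<and>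
     algebraic_complement UNIV M N}"

definition ascent :: "('a::complex_normed_vector \<Rightarrow> 'a) \<Rightarrow> enat" where
  "ascent T = Inf (enat ` {n. ker (T ^^ n) = ker (T ^^ Suc n)})"

definition descent :: "('a::complex_normed_vector \<Rightarrow> 'a) \<Rightarrow> enat" where
  "descent T = Inf (enat ` {n. range (T ^^ n) = range (T ^^ Suc n)})"

definition ess_ascent :: "('a::complex_normed_vector \<Rightarrow> 'a) \<Rightarrow> enat" where
  "ess_ascent T = Inf (enat ` {n. finite_cdim (ker T \<inter> range (T ^^ n))})"

definition ess_descent :: "('a::complex_normed_vector \<Rightarrow> 'a) \<Rightarrow> enat" where
  "ess_descent T = Inf (enat ` {n. finite_ccodim (range T + ker (T ^^ n))})"

definition dis :: "('a::complex_normed_vector \<Rightarrow> 'a) \<Rightarrow> enat" where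
  "dis T = Inf (enat ` {n. \<forall>m. m \<ge> n \<longrightarrow> m \<ge> 1 \<longrightarrow>
     ker T \<inter> range (T ^^ n) = ker T \<inter> range (T ^^ m)})"

definition saphar_type :: "('a::complex_normed_vector \<Rightarrow> 'a) \<Rightarrow> bool" where
  "saphar_type T \<longleftrightarrow> (\<exists>(M, N)\<in>Red T. saphar_on M T \<and> nilpotent_on N T)"

definition saphar_type_of_degree :: "nat \<Rightarrow> ('a::complex_normed_vector \<Rightarrow> 'a) \<Rightarrow> bool" where
  "saphar_type_of_degree d T \<longleftrightarrow>
     (\<exists>(M, N)\<in>Red T. saphar_on M T \<and> nilpotent_on N T \<and> nilpotency_degree_on N T = d)"

definition left_drazin :: "('a::complex_normed_vector \<Rightarrow> 'a) \<Rightarrow> bool" where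
  "left_drazin T \<longleftrightarrow>
     (\<exists>p. ascent T = enat p \<and> complemented_in UNIV (range T + ker (T ^^ p)))"

definition right_drazin :: "('a::complex_normed_vector \<Rightarrow> 'a) \<Rightarrow> bool" where
  "right_drazin T \<longleftrightarrow>
     (\<exists>q. descent T = enat q \<and> complemented_in UNIV (ker T \<inter> range (T ^^ q)))"

text \<open>If the essential ascent or the essential descent of \<open>T\<close> is finite then so is \<open>dis T\<close>,
  so the power \<open>T ^^ d\<close> with \<open>d = dis T\<close> below makes sense without a further hypothesis.\<close>

definition ess_left_drazin :: "('a::complex_normed_vector \<Rightarrow> 'a) \<Rightarrow> bool" where
  "ess_left_drazin T \<longleftrightarrow> ess_ascent T < \<infinity> \<and>
     (\<exists>d. dis T = enat d \<and> complemented_in UNIV (range T + ker (T ^^ d)))"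

definition ess_right_drazin :: "('a::complex_normed_vector \<Rightarrow> 'a) \<Rightarrow> bool" where
  "ess_right_drazin T \<longleftrightarrow> ess_descent T < \<infinity> \<and>
     (\<exists>d. dis T = enat d \<and> complemented_in UNIV (ker T \<inter> range (T ^^ d)))"

definition S_class :: "nat \<Rightarrow> ('a::complex_banach \<Rightarrow> 'a) set" where
  "S_class i = {T. bounded_clinear T \<and>
     (if i = 1 then saphar_type T
      else if i = 2 then left_drazin T
      else if i = 3 then right_drazin T
      else if i = 4 then ess_left_drazin T
      else if i = 5 then ess_right_drazin T
      else False)}"

definition S1_class :: "nat \<Rightarrow> ('a::complex_banach \<Rightarrow> 'a) set" where
  "S1_class i = {T. bounded_clinear T \<and>
     (if i = 1 then (\<exists>d\<le>1. saphar_type_of_degree d T)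
      else if i = 2 then left_drazin T \<and> ascent T \<le> 1
      else if i = 3 then right_drazin T \<and> descent T \<le> 1
      else if i = 4 then ess_left_drazin T \<and> ess_ascent T \<le> 1
      else if i = 5 then ess_right_drazin T \<and> ess_descent T \<le> 1
      else False)}"

end

theory Submission
  imports Defs
begin

text \<open>Everything is read off from the two monotone chains
\<open>A n = ran(T) + ker(T\<^sup>n)\<close> (increasing) and \<open>B n = ker(T) \<inter> ran(T\<^sup>n)\<close> (decreasing). Since
\<open>B n / B (n + 1)\<close> and \<open>A (n + 1) / A n\<close> are isomorphic through \<open>T\<^sup>n\<close>, both chains become
constant at the same index, which is \<open>dis T\<close>. Membership of \<open>T\<close> in each of the five classes
says that the chains become constant and that their limits \<open>A\<close> and \<open>B\<close> satisfy a certain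
condition: both complemented for Saphar type; \<open>B = 0\<close> or \<open>dim B < \<infinity>\<close> and \<open>A\<close> complemented on
the left; \<open>A = X\<close> or \<open>codim A < \<infinity>\<close> and \<open>B\<close> complemented on the right (\<open>S_class_iff\<close>).

If \<open>T = S + R\<close> with \<open>SR = RS = 0\<close> and \<open>R\<close> nilpotent, then \<open>T\<^sup>m = S\<^sup>m\<close> for large \<open>m\<close>, and \<open>S\<close> and
\<open>T\<close> have the same late terms \<open>A m\<close> and \<open>B m\<close>. Hence \<open>S\<close> and \<open>T\<close> lie in the same classes
(\<open>S_class_nilpotent_perturbation\<close>), which gives the implication from (iii) to (i).

For the implication from (i) to (ii), all five conditions imply that \<open>A\<close> and \<open>B\<close> are
complemented: a space of finite dimension is complemented by the Hahn--Banach theorem, and \<open>A\<close>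
is the range of a bounded operator, hence closed when it has a closed complement. Let
\<open>X = A \<oplus> W = B \<oplus> V\<close> with \<open>W\<close> and \<open>V\<close> closed, and let \<open>n\<close> be an index from which on the chains
are constant. Then
\<open>M = W + T W + \<dots> + T\<^bsup>n-1\<^esup> W + T\<^sup>n X\<close> and \<open>N = {x. T\<^sup>n x = 0 \<and> (\<forall>i. T\<^sup>i x \<in> V)}\<close> reduce \<open>T\<close>,
with a Saphar operator on \<open>M\<close> and a nilpotent one on \<open>N\<close> (\<open>Saphar_decomposition\<close>). With \<open>P\<close>
the projection onto \<open>M\<close> along \<open>N\<close>, the operators \<open>S = T P\<close> and \<open>R = T (1 - P)\<close> are as required:
\<open>S\<close> is in the class of \<open>T\<close> by the previous paragraph, and as \<open>S\<close> vanishes on \<open>N\<close>, its chains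
are constant from the index 1 on.

The analytic input is the closedness of \<open>M\<close> and the boundedness of \<open>P\<close>. Both come from the open
mapping theorem, which is proved here for ranges of bounded operators described by their image
of a unit ball, so that no auxiliary Banach space has to be formed.\<close>

section \<open>The Hahn--Banach theorem\<close>

definition sublinear :: "('a::real_vector \<Rightarrow> real) \<Rightarrow> bool" where
  "sublinear p \<longleftrightarrow> (\<forall>x y. p (x + y) \<le> p x + p y) \<and> (\<forall>t>0. \<forall>x. p (t *\<^sub>R x) \<le> t * p x)"

lemma sublinear_add: "sublinear p \<Longrightarrow> p (x + y) \<le> p x + p y"
  by (simp add: sublinear_def)

lemma sublinear_zero: assumes "sublinear p" shows "p 0 = 0"
proof -
  have "p (2 *\<^sub>R 0) \<le> 2 * p 0" "p ((1/2) *\<^sub>R 0) \<le> (1/2) * p 0"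
    using assms unfolding sublinear_def by (metis zero_less_numeral half_gt_zero_iff zero_less_one)+
  then show ?thesis by simp
qed

lemma sublinear_scale:
  assumes "sublinear p" "t \<ge> 0" shows "p (t *\<^sub>R x) = t * p x"
proof (cases "t = 0")
  case True then show ?thesis using sublinear_zero[OF assms(1)] by simp
next
  case False
  then have t: "t > 0" using assms by simp
  have 1: "p (t *\<^sub>R x) \<le> t * p x" using assms t by (simp add: sublinear_def)
  have "p ((1/t) *\<^sub>R (t *\<^sub>R x)) \<le> (1/t) * p (t *\<^sub>R x)"
    using assms t unfolding sublinear_def by (metis zero_less_divide_1_iff)
  then have "p x \<le> p (t *\<^sub>R x) / t" using t by simp
  then have "t * p x \<le> p (t *\<^sub>R x)" using t by (simp add: field_simps)
  with 1 show ?thesis by simp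
qed

lemma sublinear_lower: assumes "sublinear p" shows "- p (- x) \<le> p x"
  using sublinear_add[OF assms, of x "- x"] sublinear_zero[OF assms] by simp

text \<open>The limit of \<open>p (x + t y) - t p y\<close> as \<open>t \<rightarrow> \<infinity>\<close>, which is decreasing in \<open>t\<close>. It is the standard way
to lower \<open>p\<close> so that it becomes additive in the direction \<open>y\<close>.\<close>

definition slide :: "('a::real_vector \<Rightarrow> real) \<Rightarrow> 'a \<Rightarrow> 'a \<Rightarrow> real" where
  "slide p y x = (INF t\<in>{0..}. p (x + t *\<^sub>R y) - t * p y)"

lemma slide_le:
  assumes "sublinear p" "t \<ge> 0" shows "slide p y x \<le> p (x + t *\<^sub>R y) - t * p y"
  unfolding slide_def
proof (rule cINF_lower)
  have "- p (- x) \<le> p (x + s *\<^sub>R y) - s * p y" if "s \<ge> 0" for s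
    using sublinear_add[OF assms(1), of "x + s *\<^sub>R y" "- x"] sublinear_scale[OF assms(1) that, of y]
    by simp
  then show "bdd_below ((\<lambda>t. p (x + t *\<^sub>R y) - t * p y) ` {0..})"
    by (intro bdd_belowI2[where m = "- p (- x)"]) auto
qed (use assms in auto)

lemma slide_greatest:
  assumes "\<And>t. t \<ge> 0 \<Longrightarrow> b \<le> p (x + t *\<^sub>R y) - t * p y" shows "b \<le> slide p y x"
  unfolding slide_def by (rule cINF_greatest) (use assms in auto)

lemma sublinear_slide: assumes p: "sublinear p" shows "sublinear (slide p y)"
  unfolding sublinear_def
proof (intro conjI allI impI)
  fix x x' :: 'a
  have "slide p y (x + x') - (p (x' + s *\<^sub>R y) - s * p y) \<le> slide p y x" if s: "s \<ge> 0" for s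
  proof (rule slide_greatest)
    fix t :: real assume t: "t \<ge> 0"
    have "slide p y (x + x') \<le> p (x + x' + (t + s) *\<^sub>R y) - (t + s) * p y"
      by (rule slide_le[OF p]) (use s t in simp)
    also have "x + x' + (t + s) *\<^sub>R y = (x + t *\<^sub>R y) + (x' + s *\<^sub>R y)"
      by (simp add: algebra_simps)
    also have "p \<dots> \<le> p (x + t *\<^sub>R y) + p (x' + s *\<^sub>R y)" by (rule sublinear_add[OF p])
    finally show "slide p y (x + x') - (p (x' + s *\<^sub>R y) - s * p y) \<le> p (x + t *\<^sub>R y) - t * p y"
      by (simp add: algebra_simps)
  qed
  then have "slide p y (x + x') - slide p y x \<le> p (x' + s *\<^sub>R y) - s * p y" if "s \<ge> 0" for s
    using that by (simp add: algebra_simps)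
  then have "slide p y (x + x') - slide p y x \<le> slide p y x'" by (rule slide_greatest)
  then show "slide p y (x + x') \<le> slide p y x + slide p y x'" by simp
next
  fix r :: real and x :: 'a assume r: "r > 0"
  have "slide p y (r *\<^sub>R x) / r \<le> slide p y x"
  proof (rule slide_greatest)
    fix t :: real assume t: "t \<ge> 0"
    have "slide p y (r *\<^sub>R x) \<le> p (r *\<^sub>R x + (r * t) *\<^sub>R y) - (r * t) * p y"
      by (rule slide_le[OF p]) (use r t in simp)
    also have "r *\<^sub>R x + (r * t) *\<^sub>R y = r *\<^sub>R (x + t *\<^sub>R y)" by (simp add: algebra_simps)
    also have "p \<dots> = r * p (x + t *\<^sub>R y)" using r by (intro sublinear_scale[OF p]) simp
    finally show "slide p y (r *\<^sub>R x) / r \<le> p (x + t *\<^sub>R y) - t * p y"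
      using r by (simp add: field_simps)
  qed
  then show "slide p y (r *\<^sub>R x) \<le> r * slide p y x" using r by (simp add: field_simps)
qed

lemma slide_le_self: "sublinear p \<Longrightarrow> slide p y x \<le> p x"
  using slide_le[of p 0 y x] by simp

text \<open>Zorn's lemma for the pointwise order. The infimum of a chain of sublinear functionals is finite
because \<open>- p (- x)\<close> bounds all functionals below \<open>p\<close> from below, and it is subadditive because
two members of a chain have a common lower bound in the chain.\<close>

lemma exists_minimal_sublinear:
  assumes p: "sublinear p"
  obtains q where "sublinear q" "\<And>x. q x \<le> p x"
    "\<And>r. sublinear r \<Longrightarrow> (\<And>x. r x \<le> q x) \<Longrightarrow> r = q"
proof -
  define A where "A = {q. sublinear q \<and> (\<forall>x. q x \<le> p x)}"
  define P where "P = (\<lambda>a u :: 'a \<Rightarrow> real. \<forall>x. u x \<le> a x)"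
  have "\<exists>m\<in>A. \<forall>a\<in>A. P m a \<longrightarrow> a = m"
  proof (rule predicate_Zorn)
    show "partial_order_on A (relation_of P A)"
      unfolding partial_order_on_def preorder_on_def
    proof (intro conjI)
      show "refl_on A (relation_of P A)" by (auto simp: refl_on_def relation_of_def P_def)
      show "relation_of P A \<subseteq> A \<times> A" by (auto simp: relation_of_def)
      show "trans (relation_of P A)"
        unfolding trans_def relation_of_def P_def by (auto intro: order_trans)
      show "antisym (relation_of P A)"
        unfolding antisym_def relation_of_def P_def by (auto intro!: ext order_antisym)
    qed
  next
    fix C assume "C \<in> Chains (relation_of P A)"
    then have CA: "C \<subseteq> A" and ch: "\<And>a b. a \<in> C \<Longrightarrow> b \<in> C \<Longrightarrow> P a b \<or> P b a"
      by (auto simp: Chains_def relation_of_def)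
    show "\<exists>u\<in>A. \<forall>a\<in>C. P a u"
    proof (cases "C = {}")
      case True
      then show ?thesis using p by (auto simp: A_def)
    next
      case False
      define u where "u x = (INF a\<in>C. a x)" for x
      have sub: "sublinear a" "a x \<le> p x" if "a \<in> C" for a x using that CA by (auto simp: A_def)
      have lo: "u x \<le> a x" if "a \<in> C" for a x
        unfolding u_def
      proof (rule cINF_lower[OF _ that])
        have "- p (- x) \<le> a x" if "a \<in> C" for a
          using sublinear_lower[OF sub(1)[OF that], of x] sub(2)[OF that, of "- x"] by linarith
        then show "bdd_below ((\<lambda>a. a x) ` C)" by (intro bdd_belowI2) auto
      qed
      have gr: "b \<le> u x" if "\<And>a. a \<in> C \<Longrightarrow> b \<le> a x" for b x
        unfolding u_def by (rule cINF_greatest[OF False that])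
      have "sublinear u"
        unfolding sublinear_def
      proof (intro conjI allI impI)
        fix x y
        have "u (x + y) \<le> a x + b y" if ab: "a \<in> C" "b \<in> C" for a b
        proof -
          obtain c where c: "c \<in> C" "P a c" "P b c"
            using ch[OF ab] ab by (auto simp: P_def)
          have "u (x + y) \<le> c x + c y"
            using lo[OF c(1)] sublinear_add[OF sub(1)[OF c(1)]] order_trans by blast
          also have "\<dots> \<le> a x + b y" using c by (auto simp: P_def intro: add_mono)
          finally show ?thesis .
        qed
        then have "u (x + y) - b y \<le> u x" if "b \<in> C" for b
          using that by (intro gr) (simp add: algebra_simps)
        then have "u (x + y) - u x \<le> u y" by (intro gr) (simp add: algebra_simps)
        then show "u (x + y) \<le> u x + u y" by simp
      next
        fix t :: real and x assume t: "t > 0"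
        have "u (t *\<^sub>R x) / t \<le> u x"
        proof (rule gr)
          fix a assume a: "a \<in> C"
          have "u (t *\<^sub>R x) \<le> t * a x"
            using lo[OF a, of "t *\<^sub>R x"] sublinear_scale[OF sub(1)[OF a], of t x] t by simp
          then show "u (t *\<^sub>R x) / t \<le> a x" using t by (simp add: field_simps)
        qed
        then show "u (t *\<^sub>R x) \<le> t * u x" using t by (simp add: field_simps)
      qed
      moreover have "u x \<le> p x" for x
        using False lo sub(2) by (meson all_not_in_conv order_trans)
      ultimately show ?thesis using lo by (auto simp: A_def P_def)
    qed
  qed
  then obtain q where q: "q \<in> A" "\<And>a. a \<in> A \<Longrightarrow> P q a \<Longrightarrow> a = q" by blast
  show ?thesis
  proof
    show "sublinear q" "\<And>x. q x \<le> p x" using q(1) by (auto simp: A_def)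
    fix r assume r: "sublinear r" "\<And>x. r x \<le> q x"
    then have "r \<in> A" using q(1) by (auto simp: A_def intro: order_trans)
    then show "r = q" using q(2) r by (auto simp: P_def)
  qed
qed

text \<open>By minimality \<open>slide q y\<close> equals \<open>q\<close>, and at \<open>t = 1\<close> this is superadditivity.\<close>

lemma minimal_sublinear_linear:
  fixes q :: "'a::real_vector \<Rightarrow> real"
  assumes q: "sublinear q" and min: "\<And>r. sublinear r \<Longrightarrow> (\<And>x. r x \<le> q x) \<Longrightarrow> r = q"
  shows "linear q"
proof -
  have add: "q (x + y) = q x + q y" for x y
  proof -
    have "slide q y = q" by (rule min[OF sublinear_slide[OF q] slide_le_self[OF q]])
    then have "q x \<le> q (x + y) - q y" using slide_le[OF q, of 1 y x] by simp
    then show ?thesis using sublinear_add[OF q, of x y] by linarith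
  qed
  have neg: "q (- x) = - q x" for x using add[of x "- x"] sublinear_zero[OF q] by simp
  have "q (c *\<^sub>R x) = c * q x" for c x
  proof (cases "c \<ge> 0")
    case True then show ?thesis by (rule sublinear_scale[OF q])
  next
    case False
    then show ?thesis using sublinear_scale[OF q, of "- c" x] neg[of "c *\<^sub>R x"] by simp
  qed
  with add show ?thesis by (intro linearI) auto
qed

text \<open>A minimal sublinear functional below \<open>slide norm e\<close> is bounded by the norm, and its value at
\<open>- e\<close> is at most \<open>norm (e - e) - norm e\<close>.\<close>

lemma real_Hahn_Banach:
  fixes e :: "'a::real_normed_vector"
  obtains f :: "'a \<Rightarrow> real" where "bounded_linear f" "f e \<ge> norm e"
proof -
  have n: "sublinear (norm :: 'a \<Rightarrow> real)" by (auto simp: sublinear_def norm_triangle_ineq)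
  obtain q where q: "sublinear q" "\<And>x. q x \<le> slide norm e x"
    and min: "\<And>r. sublinear r \<Longrightarrow> (\<And>x. r x \<le> q x) \<Longrightarrow> r = q"
    using exists_minimal_sublinear[OF sublinear_slide[OF n]] by metis
  have lin: "linear q" by (rule minimal_sublinear_linear[OF q(1) min])
  have le: "q x \<le> norm x" for x using q(2) slide_le_self[OF n] order_trans by blast
  have "norm (q x) \<le> norm x * 1" for x
    using le[of x] le[of "- x"] linear_neg[OF lin, of x] by auto
  then have "bounded_linear q"
    using lin by (intro bounded_linear_intro[where K = 1]) (auto simp: linear_add linear_scale)
  moreover have "q (- e) \<le> - norm e"
    using q(2)[of "- e"] slide_le[OF n, of 1 e "- e"] by simp
  then have "q e \<ge> norm e" using linear_neg[OF lin, of e] by simp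
  ultimately show ?thesis using that by blast
qed

lemma bounded_linear_scaleC_right: "bounded_linear (\<lambda>x::'a::complex_normed_vector. c *\<^sub>C x)"
proof (rule bounded_linear_intro[where K = "cmod c"])
  fix x y :: 'a and r :: real
  show "c *\<^sub>C (x + y) = c *\<^sub>C x + c *\<^sub>C y" by (rule scaleC_add_right)
  show "c *\<^sub>C r *\<^sub>R x = r *\<^sub>R c *\<^sub>C x" by (simp add: scaleR_scaleC scaleC_scaleC mult.commute)
  show "norm (c *\<^sub>C x) \<le> norm x * cmod c" by (simp add: norm_scaleC)
qed

lemma bounded_linear_scaleC_left: "bounded_linear (\<lambda>c. c *\<^sub>C (x::'a::complex_normed_vector))"
proof (rule bounded_linear_intro[where K = "norm x"])
  fix c d :: complex and r :: real
  show "(c + d) *\<^sub>C x = c *\<^sub>C x + d *\<^sub>C x" by (rule scaleC_add_left)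
  show "(r *\<^sub>R c) *\<^sub>C x = r *\<^sub>R c *\<^sub>C x" by (simp add: scaleR_scaleC scaleC_scaleC scaleR_conv_of_real)
  show "norm (c *\<^sub>C x) \<le> norm c * norm x" by (simp add: norm_scaleC)
qed

lemma complex_Hahn_Banach:
  fixes e :: "'a::complex_normed_vector"
  assumes "e \<noteq> 0"
  obtains \<phi> :: "'a \<Rightarrow> complex" where "bounded_linear \<phi>" "\<And>c x. \<phi> (c *\<^sub>C x) = c * \<phi> x" "\<phi> e = 1"
proof -
  obtain f :: "'a \<Rightarrow> real" where f: "bounded_linear f" "f e \<ge> norm e" by (rule real_Hahn_Banach)
  interpret f: bounded_linear f by fact
  \<comment> \<open>The complex functional with real part \<open>f\<close>.\<close>
  define \<psi> where "\<psi> x = complex_of_real (f x) - \<i> * complex_of_real (f (\<i> *\<^sub>C x))" for x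
  have bl: "bounded_linear \<psi>"
    unfolding \<psi>_def
    by (intro bounded_linear_sub bounded_linear_const_mult bounded_linear_compose[OF bounded_linear_of_real]
        bounded_linear_compose[OF f(1)] bounded_linear_scaleC_right f(1))
  interpret \<psi>: bounded_linear \<psi> by fact
  have i: "\<psi> (\<i> *\<^sub>C x) = \<i> * \<psi> x" for x
  proof -
    have "\<i> *\<^sub>C \<i> *\<^sub>C x = - x"
      using scaleR_scaleC[of "-1" x] by (simp add: scaleC_scaleC)
    then show ?thesis by (simp add: \<psi>_def f.neg algebra_simps)
  qed
  have sc: "\<psi> (c *\<^sub>C x) = c * \<psi> x" for c x
  proof -
    have "c *\<^sub>C x = Re c *\<^sub>R x + Im c *\<^sub>R \<i> *\<^sub>C x"
      by (metis (no_types) complex_eq scaleC_add_left scaleC_scaleC scaleR_scaleC mult.commute)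
    then have "\<psi> (c *\<^sub>C x) = Re c *\<^sub>R \<psi> x + Im c *\<^sub>R \<psi> (\<i> *\<^sub>C x)"
      by (simp add: \<psi>.add \<psi>.scaleR)
    also have "\<dots> = (of_real (Re c) + \<i> * of_real (Im c)) * \<psi> x"
      by (simp add: i scaleR_conv_of_real algebra_simps)
    finally show ?thesis by (simp flip: complex_eq)
  qed
  have "Re (\<psi> e) \<noteq> 0" using f(2) assms by (simp add: \<psi>_def) (metis norm_le_zero_iff)
  then have ne: "\<psi> e \<noteq> 0" by auto
  show ?thesis
  proof
    show "bounded_linear (\<lambda>x. \<psi> x / \<psi> e)" by (intro bounded_linear_divide[THEN bounded_linear_compose] bl)
    show "\<psi> (c *\<^sub>C x) / \<psi> e = c * (\<psi> x / \<psi> e)" for c x by (simp add: sc)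
    show "\<psi> e / \<psi> e = 1" using ne by simp
  qed
qed

section \<open>Operator ranges and the open mapping theorem\<close>

text \<open>The image of a closed unit ball under a bounded operator between Banach spaces is a bounded,
absolutely convex set that contains the dyadic series of its elements. These properties are all
that the open mapping theorem uses, and unlike the operator they do not mention a second space.\<close>

definition sigma_disk :: "'a::real_normed_vector set \<Rightarrow> bool" where
  "sigma_disk C \<longleftrightarrow> bounded C \<and> convex C \<and> 0 \<in> C \<and> (\<forall>x\<in>C. - x \<in> C) \<and>
     (\<forall>c. (\<forall>n. c n \<in> C) \<longrightarrow> (\<Sum>n. (1/2)^Suc n *\<^sub>R c n) \<in> C)"

lemma sigma_disk_series:
  "sigma_disk C \<Longrightarrow> (\<And>n. c n \<in> C) \<Longrightarrow> (\<Sum>n. (1/2)^Suc n *\<^sub>R c n) \<in> C"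
  unfolding sigma_disk_def by simp

lemma sigma_diskD:
  assumes "sigma_disk C"
  shows "bounded C" "convex C" "0 \<in> C" "x \<in> C \<Longrightarrow> - x \<in> C"
  using assms by (simp_all add: sigma_disk_def)

lemma sigma_diskI:
  assumes "bounded C" "convex C" "0 \<in> C" "\<And>x. x \<in> C \<Longrightarrow> - x \<in> C"
    and "\<And>c. (\<And>n. c n \<in> C) \<Longrightarrow> (\<Sum>n. (1/2)^Suc n *\<^sub>R c n) \<in> C"
  shows "sigma_disk C"
  using assms unfolding sigma_disk_def by simp

text \<open>A subspace with this property is the range of a bounded operator, namely of the inclusion of \<open>V\<close>
normed by the gauge of \<open>C\<close>.\<close>

definition operator_range :: "'a::real_normed_vector set \<Rightarrow> bool" where
  "operator_range V \<longleftrightarrow> (\<exists>C. sigma_disk C \<and> C \<subseteq> V \<and> (\<forall>x\<in>V. \<exists>r>0. r *\<^sub>R x \<in> C))"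

lemma dyadic_summable:
  fixes c :: "nat \<Rightarrow> 'a::banach"
  assumes "bounded C" "\<And>n. c n \<in> C"
  shows "summable (\<lambda>n. (1/2)^Suc n *\<^sub>R c n)"
proof -
  obtain K where K: "\<And>x. x \<in> C \<Longrightarrow> norm x \<le> K" using assms(1) by (auto simp: bounded_iff)
  show ?thesis
  proof (rule summable_comparison_test)
    show "\<exists>N. \<forall>n\<ge>N. norm ((1/2)^Suc n *\<^sub>R c n) \<le> (1/2)^Suc n * K"
      using K assms(2) by (auto intro!: mult_left_mono divide_right_mono)
    show "summable (\<lambda>n. (1/2::real)^Suc n * K)"
      using power_half_series sums_summable summable_mult2 by blast
  qed
qed

lemma sigma_disk_scale:
  assumes "sigma_disk C" "x \<in> C" "0 \<le> r" "r \<le> 1" shows "r *\<^sub>R x \<in> C"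
proof -
  have "convex C" "0 \<in> C" using sigma_diskD[OF assms(1)] by auto
  from convexD[OF this(1) assms(2) this(2), of r "1 - r"] show ?thesis using assms by simp
qed

lemma sigma_disk_image:
  fixes T :: "'a::banach \<Rightarrow> 'b::banach"
  assumes T: "bounded_linear T" and C: "sigma_disk C" shows "sigma_disk (T ` C)"
proof -
  interpret T: bounded_linear T by fact
  show ?thesis
  proof (rule sigma_diskI)
    show "bounded (T ` C)" using sigma_diskD(1)[OF C] T by (rule bounded_linear_image)
    show "convex (T ` C)" by (intro convex_linear_image T.linear_axioms sigma_diskD(2)[OF C])
    show "0 \<in> T ` C" using sigma_diskD(3)[OF C] by (intro image_eqI[of 0 T 0]) (simp_all add: T.zero)
    fix y assume "y \<in> T ` C"
    then obtain x where "x \<in> C" "y = T x" by auto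
    then show "- y \<in> T ` C"
      using sigma_diskD(4)[OF C] by (intro image_eqI[of _ T "- x"]) (simp_all add: T.neg)
  next
    fix d :: "nat \<Rightarrow> 'b" assume d: "\<And>n. d n \<in> T ` C"
    define c where "c n = (SOME x. x \<in> C \<and> d n = T x)" for n
    have c: "c n \<in> C \<and> d n = T (c n)" for n
      unfolding c_def by (rule someI_ex) (use d[of n] in blast)
    have "T (\<Sum>n. (1/2)^Suc n *\<^sub>R c n) = (\<Sum>n. T ((1/2)^Suc n *\<^sub>R c n))"
      by (rule T.suminf[OF dyadic_summable[OF sigma_diskD(1)[OF C]]]) (simp add: c)
    also have "\<dots> = (\<Sum>n. (1/2)^Suc n *\<^sub>R d n)"
      by (rule suminf_cong) (metis c T.scaleR)
    finally have eq: "T (\<Sum>n. (1/2)^Suc n *\<^sub>R c n) = (\<Sum>n. (1/2)^Suc n *\<^sub>R d n)" .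
    have "(\<Sum>n. (1/2)^Suc n *\<^sub>R c n) \<in> C" by (rule sigma_disk_series[OF C]) (simp add: c)
    from imageI[OF this, of T] show "(\<Sum>n. (1/2)^Suc n *\<^sub>R d n) \<in> T ` C" unfolding eq .
  qed
qed

lemma sigma_disk_plus:
  fixes C D :: "'a::banach set"
  assumes C: "sigma_disk C" and D: "sigma_disk D" shows "sigma_disk (C + D)"
proof (rule sigma_diskI)
  have "C + D = (\<Union>x\<in>C. \<Union>y\<in>D. {x + y})" by (auto simp: set_plus_def)
  then show "bounded (C + D)"
    using bounded_sums[OF sigma_diskD(1)[OF C] sigma_diskD(1)[OF D]] by simp
  show "convex (C + D)" by (intro convex_set_plus sigma_diskD(2)[OF C] sigma_diskD(2)[OF D])
  show "0 \<in> C + D" using set_plus_intro[OF sigma_diskD(3)[OF C] sigma_diskD(3)[OF D]] by simp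
  fix x assume "x \<in> C + D"
  then obtain c d where cd: "c \<in> C" "d \<in> D" "x = c + d" by (rule set_plus_elim)
  show "- x \<in> C + D"
    using set_plus_intro[OF sigma_diskD(4)[OF C cd(1)] sigma_diskD(4)[OF D cd(2)]] cd(3) by simp
next
  fix e :: "nat \<Rightarrow> 'a" assume e: "\<And>n. e n \<in> C + D"
  have "\<exists>c d. e n = c + d \<and> c \<in> C \<and> d \<in> D" for n
    using set_plus_elim[OF e[of n]] by blast
  then obtain c d where c: "\<And>n. e n = c n + d n \<and> c n \<in> C \<and> d n \<in> D" by metis
  have "(\<Sum>n. (1/2)^Suc n *\<^sub>R c n) + (\<Sum>n. (1/2)^Suc n *\<^sub>R d n)
      = (\<Sum>n. (1/2)^Suc n *\<^sub>R c n + (1/2)^Suc n *\<^sub>R d n)"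
    by (intro suminf_add dyadic_summable[OF sigma_diskD(1)[OF C]]
        dyadic_summable[OF sigma_diskD(1)[OF D]]) (simp_all add: c)
  also have "\<dots> = (\<Sum>n. (1/2)^Suc n *\<^sub>R e n)"
    by (rule suminf_cong) (simp only: c scaleR_add_right)
  finally have eq: "(\<Sum>n. (1/2)^Suc n *\<^sub>R c n) + (\<Sum>n. (1/2)^Suc n *\<^sub>R d n)
      = (\<Sum>n. (1/2)^Suc n *\<^sub>R e n)" .
  have "(\<Sum>n. (1/2)^Suc n *\<^sub>R c n) \<in> C" "(\<Sum>n. (1/2)^Suc n *\<^sub>R d n) \<in> D"
    by (rule sigma_disk_series[OF C], simp add: c) (rule sigma_disk_series[OF D], simp add: c)
  from set_plus_intro[OF this] show "(\<Sum>n. (1/2)^Suc n *\<^sub>R e n) \<in> C + D" unfolding eq .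
qed

lemma sigma_disk_closed_subspace:
  fixes W :: "'a::banach set"
  assumes W: "closed W" "subspace W" shows "sigma_disk (W \<inter> cball 0 1)"
proof (rule sigma_diskI)
  show b: "bounded (W \<inter> cball 0 1)" by (simp add: bounded_Int)
  show "convex (W \<inter> cball 0 1)" by (intro convex_Int subspace_imp_convex W convex_cball)
  show "0 \<in> W \<inter> cball 0 1" using W by (simp add: subspace_0)
  show "- x \<in> W \<inter> cball 0 1" if "x \<in> W \<inter> cball 0 1" for x
    using that W by (simp add: subspace_neg)
  fix c :: "nat \<Rightarrow> 'a" assume c: "\<And>n. c n \<in> W \<inter> cball 0 1"
  have s: "summable (\<lambda>n. (1/2)^Suc n *\<^sub>R c n)" by (rule dyadic_summable[OF b]) (rule c)
  have "(\<lambda>n. \<Sum>i<n. (1/2)^Suc i *\<^sub>R c i) \<longlonglongrightarrow> (\<Sum>n. (1/2)^Suc n *\<^sub>R c n)"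
    by (rule summable_LIMSEQ[OF s])
  moreover have "(\<Sum>i<n. (1/2)^Suc i *\<^sub>R c i) \<in> W" for n
    by (intro subspace_sum subspace_scale W) (use c in blast)
  ultimately have 1: "(\<Sum>n. (1/2)^Suc n *\<^sub>R c n) \<in> W"
    by (rule closed_sequentially[OF W(1), rotated])
  have "norm (\<Sum>n. (1/2)^Suc n *\<^sub>R c n) \<le> (\<Sum>n. (1/2)^Suc n)"
  proof (rule norm_suminf_le)
    fix n
    have "norm (c n) \<le> 1" using c[of n] by simp
    from mult_left_mono[OF this, of "(1/2)^Suc n"]
    show "norm ((1/2)^Suc n *\<^sub>R c n) \<le> (1/2)^Suc n" by simp
    show "summable (\<lambda>n. (1/2::real)^Suc n)" using power_half_series by (rule sums_summable)
  qed
  also have "\<dots> = 1" using power_half_series by (rule sums_unique[symmetric])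
  finally show "(\<Sum>n. (1/2)^Suc n *\<^sub>R c n) \<in> W \<inter> cball 0 1" using 1 by simp
qed

lemma operator_range_closed_subspace:
  fixes W :: "'a::banach set"
  assumes W: "closed W" "subspace W" shows "operator_range W"
  unfolding operator_range_def
proof (intro exI[of _ "W \<inter> cball 0 1"] conjI ballI)
  show "sigma_disk (W \<inter> cball 0 1)" by (rule sigma_disk_closed_subspace[OF W])
  fix x assume x: "x \<in> W"
  have "norm x / (norm x + 1) \<le> 1" by (simp add: divide_le_eq_1 add_nonneg_pos)
  then show "\<exists>r>0. r *\<^sub>R x \<in> W \<inter> cball 0 1"
    using x W(2) by (intro exI[of _ "1 / (norm x + 1)"]) (auto simp: subspace_scale add_nonneg_pos)
qed auto

lemma operator_range_image:
  fixes T :: "'a::banach \<Rightarrow> 'b::banach"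
  assumes T: "bounded_linear T" and V: "operator_range V" shows "operator_range (T ` V)"
proof -
  interpret T: bounded_linear T by fact
  obtain C where C: "sigma_disk C" "C \<subseteq> V" "\<And>x. x \<in> V \<Longrightarrow> \<exists>r>0. r *\<^sub>R x \<in> C"
    using V unfolding operator_range_def by blast
  show ?thesis unfolding operator_range_def
  proof (intro exI[of _ "T ` C"] conjI ballI)
    show "sigma_disk (T ` C)" by (rule sigma_disk_image[OF T C(1)])
    show "T ` C \<subseteq> T ` V" using C by auto
    fix y assume "y \<in> T ` V"
    then obtain x where x: "x \<in> V" "y = T x" by auto
    obtain r where "r > 0" "r *\<^sub>R x \<in> C" using C(3)[OF x(1)] by auto
    then show "\<exists>r>0. r *\<^sub>R y \<in> T ` C" using x by (metis T.scaleR imageI)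
  qed
qed

lemma operator_range_plus:
  fixes V W :: "'a::banach set"
  assumes V: "operator_range V" and W: "operator_range W" shows "operator_range (V + W)"
proof -
  obtain C where C: "sigma_disk C" "C \<subseteq> V" "\<And>x. x \<in> V \<Longrightarrow> \<exists>r>0. r *\<^sub>R x \<in> C"
    using V unfolding operator_range_def by blast
  obtain D where D: "sigma_disk D" "D \<subseteq> W" "\<And>x. x \<in> W \<Longrightarrow> \<exists>r>0. r *\<^sub>R x \<in> D"
    using W unfolding operator_range_def by blast
  show ?thesis unfolding operator_range_def
  proof (intro exI[of _ "C + D"] conjI ballI)
    show "sigma_disk (C + D)" by (rule sigma_disk_plus[OF C(1) D(1)])
    show "C + D \<subseteq> V + W" using C(2) D(2) by (rule set_plus_mono2)
    fix y assume "y \<in> V + W"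
    then obtain v w where y: "v \<in> V" "w \<in> W" "y = v + w" by (auto simp: set_plus_def)
    obtain r s where rs: "r > 0" "r *\<^sub>R v \<in> C" "s > 0" "s *\<^sub>R w \<in> D" using C(3) D(3) y by meson
    define t where "t = min r s"
    have t: "t > 0" "t / r \<le> 1" "t / s \<le> 1" using rs by (auto simp: t_def)
    have "t *\<^sub>R v \<in> C" using sigma_disk_scale[OF C(1) rs(2), of "t / r"] t rs by simp
    moreover have "t *\<^sub>R w \<in> D" using sigma_disk_scale[OF D(1) rs(4), of "t / s"] t rs by simp
    ultimately have "t *\<^sub>R y \<in> C + D" using y by (simp add: scaleR_add_right set_plus_intro)
    then show "\<exists>r>0. r *\<^sub>R y \<in> C + D" using t by blast
  qed
qed

text \<open>The open mapping theorem. By Baire's theorem the closure of some multiple of \<open>C\<close> has interior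
points, hence the closure of \<open>C\<close> contains a ball. A point of half that ball is then the limit of a
dyadic series in \<open>C\<close>: approximate, double the error, and repeat.\<close>

lemma absorbing_sigma_disk_contains_ball:
  fixes C :: "'a::banach set"
  assumes C: "sigma_disk C" and ab: "\<And>x. \<exists>r>0. r *\<^sub>R x \<in> C"
  obtains \<delta> where "\<delta> > 0" "ball 0 \<delta> \<subseteq> C"
proof -
  have bC: "bounded C" and cC: "convex C" and sC: "\<And>x. x \<in> C \<Longrightarrow> - x \<in> C"
    using sigma_diskD[OF C] by auto
  define F where "F n = closure ((\<lambda>x. real (Suc n) *\<^sub>R x) ` C)" for n
  have F_eq: "F n = (\<lambda>x. real (Suc n) *\<^sub>R x) ` closure C" for n
    unfolding F_def by (rule closure_scaleR[symmetric])
  have "x \<in> \<Union>(range F)" for x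
  proof -
    obtain r where r: "r > 0" "r *\<^sub>R x \<in> C" using ab by auto
    obtain n where n: "inverse (real (Suc n)) < r" using reals_Archimedean[OF r(1)] by auto
    have "inverse (real (Suc n)) / r \<le> 1" using n r by simp
    then have "inverse (real (Suc n)) *\<^sub>R x \<in> C"
      using sigma_disk_scale[OF C r(2), of "inverse (real (Suc n)) / r"] r by simp
    then have "real (Suc n) *\<^sub>R inverse (real (Suc n)) *\<^sub>R x \<in> (\<lambda>x. real (Suc n) *\<^sub>R x) ` C"
      by (rule imageI)
    then have "x \<in> F n" unfolding F_def using closure_subset by fastforce
    then show ?thesis by auto
  qed
  then have un: "\<Union>(range F) = UNIV" by auto
  have "\<exists>n. interior (F n) \<noteq> {}"
  proof (rule ccontr)
    assume "\<not> ?thesis"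
    then have "(euclidean :: 'a topology) interior_of \<Union>(range F) = {}"
      by (intro Baire_category_alt) (auto simp: completely_metrizable_space_euclidean F_def)
    then show False using un by simp
  qed
  then obtain n x e where e: "e > 0" "ball x e \<subseteq> F n"
    by (metis all_not_in_conv mem_interior)
  have cF: "convex (F n)" unfolding F_eq by (intro convex_scaling convex_closure cC)
  have sF: "- y \<in> F n" if y: "y \<in> F n" for y
  proof -
    have "uminus ` closure C = closure (uminus ` C)"
      using closure_scaleR[of "-1" C] by simp
    also have "uminus ` C = C" using sC by force
    finally have neg: "uminus ` closure C = closure C" .
    obtain w where w: "w \<in> closure C" "y = real (Suc n) *\<^sub>R w" using y unfolding F_eq by blast
    have "- w \<in> closure C" using imageI[OF w(1), of uminus] unfolding neg .
    from imageI[OF this, of "\<lambda>x. real (Suc n) *\<^sub>R x"] show ?thesis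
      unfolding F_eq by (simp only: w(2) scaleR_minus_right)
  qed
  have ball_F: "ball 0 e \<subseteq> F n"
  proof
    fix y :: 'a assume "y \<in> ball 0 e"
    then have "x + y \<in> ball x e" "x - y \<in> ball x e" by (auto simp: dist_norm)
    then have "x + y \<in> F n" "- (x - y) \<in> F n" using e sF by blast+
    from convexD[OF cF this, of "1/2" "1/2"] show "y \<in> F n"
      by (simp add: scaleR_add_right scaleR_diff_right flip: scaleR_add_left)
  qed
  define \<delta> where "\<delta> = e / real (Suc n)"
  have \<delta>: "\<delta> > 0" using e by (simp add: \<delta>_def)
  have ball_C: "y \<in> closure C" if "norm y < \<delta>" for y
  proof -
    have "norm (real (Suc n) *\<^sub>R y) < e"
      using that unfolding norm_scaleR by (simp add: \<delta>_def pos_less_divide_eq mult.commute del: of_nat_Suc)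
    then have "real (Suc n) *\<^sub>R y \<in> F n" using ball_F by auto
    then show ?thesis unfolding F_eq by (auto simp del: of_nat_Suc)
  qed
  have "y \<in> C" if y: "norm y < \<delta> / 2" for y
  proof -
    have "\<exists>c. c \<in> C \<and> norm (z - c) < \<delta> / 2" if "norm z < \<delta>" for z
      using ball_C[OF that] \<delta> unfolding closure_approachable
      by (metis dist_norm norm_minus_commute half_gt_zero)
    then obtain g where g: "\<And>z. norm z < \<delta> \<Longrightarrow> g z \<in> C \<and> norm (z - g z) < \<delta> / 2" by metis
    \<comment> \<open>\<open>z k\<close> is the error after \<open>k\<close> approximations, rescaled to the size of the ball.\<close>
    define z where "z = rec_nat (2 *\<^sub>R y) (\<lambda>_ w. 2 *\<^sub>R (w - g w))"
    have z: "z 0 = 2 *\<^sub>R y" "z (Suc k) = 2 *\<^sub>R (z k - g (z k))" for k by (simp_all add: z_def)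
    have nz: "norm (z k) < \<delta>" for k
    proof (induction k)
      case 0 then show ?case using y by (simp add: z)
    next
      case (Suc k) then show ?case using g[OF Suc] by (simp add: z)
    qed
    have part: "(\<Sum>k<m. (1/2)^Suc k *\<^sub>R g (z k)) = y - (1/2)^Suc m *\<^sub>R z m" for m
    proof (induction m)
      case 0 then show ?case by (simp add: z)
    next
      case (Suc m) then show ?case by (simp add: z algebra_simps)
    qed
    have "(\<lambda>m. (1/2)^Suc m *\<^sub>R z m) \<longlonglongrightarrow> 0"
    proof (rule Lim_null_comparison)
      show "\<forall>\<^sub>F m in sequentially. norm ((1/2)^Suc m *\<^sub>R z m) \<le> (1/2)^Suc m * \<delta>"
        using nz by (intro always_eventually allI) (simp add: less_imp_le)
      have "(\<lambda>m. (1/2::real)^m * (\<delta>/2)) \<longlonglongrightarrow> 0"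
        by (intro tendsto_mult_left_zero LIMSEQ_power_zero) auto
      then show "(\<lambda>m. (1/2::real)^Suc m * \<delta>) \<longlonglongrightarrow> 0" by simp
    qed
    then have "(\<lambda>m. y - (1/2)^Suc m *\<^sub>R z m) \<longlonglongrightarrow> y - 0" by (intro tendsto_diff tendsto_const)
    then have "(\<lambda>k. (1/2)^Suc k *\<^sub>R g (z k)) sums y" unfolding sums_def part by simp
    then have "y = (\<Sum>k. (1/2)^Suc k *\<^sub>R g (z k))" by (rule sums_unique)
    also have "\<dots> \<in> C" using g nz by (intro sigma_disk_series[OF C]) auto
    finally show ?thesis .
  qed
  then have "ball 0 (\<delta> / 2) \<subseteq> C" by auto
  then show ?thesis using that[of "\<delta> / 2"] \<delta> by simp
qed

text \<open>The component in \<open>N\<close> depends continuously on the vector, because the sum of a disk in \<open>V\<close> and the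
unit ball of \<open>N\<close> contains a ball.\<close>

lemma complement_of_operator_range_bound:
  fixes V N :: "'a::banach set"
  assumes V: "operator_range V" "subspace V" and N: "closed N" "subspace N"
    and int: "V \<inter> N = {0}" and sum: "V + N = UNIV"
  obtains K where "\<And>v n. v \<in> V \<Longrightarrow> n \<in> N \<Longrightarrow> norm n \<le> K * norm (v + n)"
proof -
  obtain C where C: "sigma_disk C" "C \<subseteq> V" "\<And>x. x \<in> V \<Longrightarrow> \<exists>r>0. r *\<^sub>R x \<in> C"
    using V unfolding operator_range_def by blast
  let ?D = "N \<inter> cball 0 1"
  have D: "sigma_disk ?D" by (rule sigma_disk_closed_subspace[OF N])
  have "\<exists>r>0. r *\<^sub>R x \<in> C + ?D" for x
  proof -
    obtain v n where x: "v \<in> V" "n \<in> N" "x = v + n" using sum by (metis UNIV_I set_plus_elim)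
    obtain r where r: "r > 0" "r *\<^sub>R v \<in> C" using C(3)[OF x(1)] by auto
    define t where "t = min r (1 / (norm n + 1))"
    have t: "t > 0" "t \<le> r" "t * norm n \<le> 1"
    proof -
      show "t > 0" "t \<le> r" using r by (auto simp: t_def add_nonneg_pos)
      have "t * norm n \<le> (1 / (norm n + 1)) * norm n" by (rule mult_right_mono) (auto simp: t_def)
      also have "\<dots> \<le> 1" by (simp add: divide_le_eq_1 add_nonneg_pos)
      finally show "t * norm n \<le> 1" .
    qed
    have "t *\<^sub>R v \<in> C" using sigma_disk_scale[OF C(1) r(2), of "t / r"] t r by simp
    moreover have "t *\<^sub>R n \<in> ?D" using x t N by (auto simp: subspace_scale)
    ultimately have "t *\<^sub>R x \<in> C + ?D" using x by (simp add: scaleR_add_right set_plus_intro)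
    with t show ?thesis by blast
  qed
  then obtain \<delta> where \<delta>: "\<delta> > 0" "ball 0 \<delta> \<subseteq> C + ?D"
    using absorbing_sigma_disk_contains_ball[OF sigma_disk_plus[OF C(1) D]] by metis
  show ?thesis
  proof
    fix v n assume vn: "v \<in> V" "n \<in> N"
    show "norm n \<le> 2 / \<delta> * norm (v + n)"
    proof (cases "v + n = 0")
      case True
      then have "n = - v" by (simp add: eq_neg_iff_add_eq_0 add.commute)
      then have "n \<in> V \<inter> N" using vn V(2) by (auto simp: subspace_neg)
      then show ?thesis using int \<delta> by simp
    next
      case False
      define s where "s = \<delta> / (2 * norm (v + n))"
      have s: "s > 0" using False \<delta> by (simp add: s_def)
      have "norm (s *\<^sub>R (v + n)) < \<delta>" using False \<delta> by (simp add: s_def)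
      then have "s *\<^sub>R (v + n) \<in> C + ?D" using \<delta> by auto
      then obtain c d where cd: "c \<in> C" "d \<in> ?D" "s *\<^sub>R (v + n) = c + d" by (auto simp: set_plus_def)
      have "s *\<^sub>R v - c \<in> V" using vn C cd V by (intro subspace_diff subspace_scale) auto
      moreover have "s *\<^sub>R v - c = d - s *\<^sub>R n" using cd(3) by (simp add: algebra_simps)
      moreover have "d - s *\<^sub>R n \<in> N" using vn cd N by (intro subspace_diff subspace_scale) auto
      ultimately have "d - s *\<^sub>R n \<in> V \<inter> N" by simp
      then have "d = s *\<^sub>R n" using int by simp
      then have "s * norm n \<le> 1" using cd s by simp
      then show ?thesis using False \<delta> by (simp add: s_def field_simps)
    qed
  qed
qed

text \<open>If \<open>f k \<in> V\<close> tends to \<open>v + n\<close>, then \<open>n\<close> is the component in \<open>N\<close> of \<open>(v + n) - f k\<close> for every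
\<open>k\<close>, hence zero by continuity of that component.\<close>

lemma closed_operator_range_complement:
  fixes V N :: "'a::banach set"
  assumes V: "operator_range V" "subspace V" and N: "closed N" "subspace N"
    and int: "V \<inter> N = {0}" and sum: "V + N = UNIV"
  shows "closed V"
proof -
  obtain K where K: "\<And>v n. v \<in> V \<Longrightarrow> n \<in> N \<Longrightarrow> norm n \<le> K * norm (v + n)"
    using complement_of_operator_range_bound[OF assms] by blast
  show ?thesis unfolding closed_sequential_limits
  proof (intro allI impI)
    fix f x assume f: "(\<forall>k. f k \<in> V) \<and> f \<longlonglongrightarrow> x"
    obtain v n where x: "v \<in> V" "n \<in> N" "x = v + n" using sum by (metis UNIV_I set_plus_elim)
    have "norm n \<le> K * norm (x - f k)" for k
      using K[of "v - f k" n] f x V(2) by (simp add: subspace_diff algebra_simps)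
    moreover have "(\<lambda>k. K * norm (x - f k)) \<longlonglongrightarrow> K * norm (x - x)"
      using f by (intro tendsto_intros) auto
    ultimately have "norm n \<le> K * norm (x - x)"
      by (intro LIMSEQ_le_const) auto
    then show "x \<in> V" using x by simp
  qed
qed

lemma csubspace_subspace: "csubspace V \<Longrightarrow> subspace V"
  unfolding complex_vector.subspace_def subspace_def by (auto simp: scaleR_scaleC)

lemma complementary_projection:
  fixes M N :: "'a::complex_banach set"
  assumes M: "closed M" and N: "closed N" and c: "algebraic_complement UNIV M N"
  obtains P where "bounded_clinear P" "\<And>x. P x \<in> M" "\<And>x. x - P x \<in> N"
    "\<And>x. x \<in> M \<Longrightarrow> P x = x" "\<And>x. x \<in> N \<Longrightarrow> P x = 0"
proof -
  have cs: "csubspace M" "csubspace N" and int: "M \<inter> N = {0}" and sum: "M + N = UNIV"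
    using c by (auto simp: algebraic_complement_def)
  note s = cs[THEN csubspace_subspace]
  have "\<exists>m. m \<in> M \<and> x - m \<in> N" for x
  proof -
    have "x \<in> M + N" using sum by simp
    then show ?thesis by (auto simp: set_plus_def)
  qed
  then obtain P where P: "\<And>x. P x \<in> M" "\<And>x. x - P x \<in> N" by metis
  have uniq: "P x = m" if "m \<in> M" "x - m \<in> N" for x m
  proof -
    have "P x - m \<in> M" by (intro subspace_diff s P that)
    moreover have "(x - m) - (x - P x) \<in> N" by (intro subspace_diff s P that)
    ultimately have "P x - m \<in> M \<inter> N" by simp
    then show ?thesis using int by simp
  qed
  obtain K where K: "\<And>v n. v \<in> N \<Longrightarrow> n \<in> M \<Longrightarrow> norm n \<le> K * norm (v + n)"
    using complement_of_operator_range_bound[OF operator_range_closed_subspace[OF N s(2)] s(2) M s(1)]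
      int sum by (auto simp: Int_commute add.commute)
  have sc: "P (c *\<^sub>C x) = c *\<^sub>C P x" for c x
  proof (rule uniq)
    show "c *\<^sub>C P x \<in> M" using P cs by (simp add: complex_vector.subspace_scale)
    have "c *\<^sub>C (x - P x) \<in> N" using P cs by (simp add: complex_vector.subspace_scale)
    then show "c *\<^sub>C x - c *\<^sub>C P x \<in> N" by (simp add: complex_vector.scale_right_diff_distrib)
  qed
  have "bounded_linear P"
  proof (rule bounded_linear_intro[where K = K])
    fix x y :: 'a and r :: real
    show "P (x + y) = P x + P y"
    proof (rule uniq)
      show "P x + P y \<in> M" by (intro subspace_add s P)
      have "(x - P x) + (y - P y) \<in> N" by (intro subspace_add s P)
      then show "x + y - (P x + P y) \<in> N" by (simp add: algebra_simps)
    qed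
    show "P (r *\<^sub>R x) = r *\<^sub>R P x" by (simp add: scaleR_scaleC sc)
    show "norm (P x) \<le> norm x * K" using K[OF P(2) P(1), of x x] by (simp add: mult.commute)
  qed
  then show ?thesis
    using that[of P] P uniq sc s by (auto simp: bounded_clinear_def subspace_0)
qed

section \<open>Complemented subspaces\<close>

lemma complemented_in_UNIV:
  "complemented_in UNIV V \<longleftrightarrow> closed V \<and> (\<exists>W. closed W \<and> algebraic_complement UNIV V W)"
  by (simp add: complemented_in_def)

lemma complemented_range_projection:
  fixes P :: "'a::complex_normed_vector \<Rightarrow> 'a"
  assumes P: "bounded_clinear P" and id: "\<And>x. P (P x) = P x"
  shows "complemented_in UNIV (range P)"
proof -
  interpret P: bounded_linear P using P by (simp add: bounded_clinear_def)
  have sc: "P (c *\<^sub>C x) = c *\<^sub>C P x" for c x using P by (simp add: bounded_clinear_def)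
  have r: "range P = {x. P x = x}" 
  proof (intro set_eqI iffI)
    show "x \<in> range P" if "x \<in> {x. P x = x}" for x using that rangeI[of P x] by simp
  qed (auto simp: id)
  have "closed (range P)" unfolding r
    by (intro closed_Collect_eq P.continuous_on continuous_on_id)
  moreover have "closed {x. P x = 0}"
    by (intro closed_Collect_eq P.continuous_on continuous_on_id continuous_on_const)
  moreover have "algebraic_complement UNIV (range P) {x. P x = 0}"
    unfolding algebraic_complement_def
  proof (intro conjI)
    show "csubspace (range P)" unfolding r
      by (auto simp: complex_vector.subspace_def P.zero P.add sc)
    show "csubspace {x. P x = 0}"
      by (auto simp: complex_vector.subspace_def P.zero P.add sc)
    show "range P \<inter> {x. P x = 0} = {0}" unfolding r by (auto simp: P.zero)
    have "x \<in> range P + {x. P x = 0}" for x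
    proof -
      have "P (x - P x) = 0" by (simp add: P.diff id)
      then have "P x + (x - P x) \<in> range P + {x. P x = 0}" by (intro set_plus_intro) auto
      then show ?thesis by simp
    qed
    then show "range P + {x. P x = 0} = UNIV" by auto
  qed
  ultimately show ?thesis unfolding complemented_in_UNIV by blast
qed

text \<open>If \<open>P\<close> projects onto the span of \<open>S\<close> and \<open>g = a - P a \<noteq> 0\<close>, then a functional \<open>\<phi>\<close> with \<open>\<phi> g = 1\<close>
yields the projection \<open>x \<mapsto> P x + \<phi> (x - P x) g\<close> onto the span of \<open>insert a S\<close>.\<close>

lemma finite_span_range_projection:
  fixes S :: "'a::complex_normed_vector set"
  assumes "finite S"
  shows "\<exists>P. bounded_clinear P \<and> (\<forall>x. P (P x) = P x) \<and> range P = cspan S"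
  using assms
proof (induction S)
  case empty
  show ?case
    by (rule exI[of _ "\<lambda>_. 0"]) (auto simp: bounded_clinear_def)
next
  case (insert a S)
  then obtain P where P: "bounded_clinear P" and id: "\<And>x. P (P x) = P x" and r: "range P = cspan S"
    by auto
  interpret P: bounded_linear P using P by (simp add: bounded_clinear_def)
  have sc: "P (c *\<^sub>C x) = c *\<^sub>C P x" for c x using P by (simp add: bounded_clinear_def)
  define g where "g = a - P a"
  have Pg: "P g = 0" by (simp add: g_def P.diff id)
  show ?case
  proof (cases "g = 0")
    case True
    then have "a = P a" by (simp add: g_def)
    then have "a \<in> cspan S" using r by (metis rangeI)
    then have "cspan (insert a S) = cspan S" by (rule complex_vector.span_redundant)
    then show ?thesis using P id r by auto
  next
    case False
    obtain \<phi> :: "'a \<Rightarrow> complex" where \<phi>: "bounded_linear \<phi>" "\<And>c x. \<phi> (c *\<^sub>C x) = c * \<phi> x" "\<phi> g = 1"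
      using complex_Hahn_Banach[OF False] by metis
    interpret \<phi>: bounded_linear \<phi> by fact
    define Q where "Q x = P x + \<phi> (x - P x) *\<^sub>C g" for x
    have "bounded_linear (\<lambda>x. \<phi> (x - P x))"
      by (intro bounded_linear_compose[OF \<phi>(1)] bounded_linear_sub bounded_linear_ident P.bounded_linear_axioms)
    then have "bounded_linear Q" unfolding Q_def
      by (intro bounded_linear_add P.bounded_linear_axioms bounded_linear_compose[OF bounded_linear_scaleC_left])
    moreover have "Q (c *\<^sub>C x) = c *\<^sub>C Q x" for c x
      by (simp add: Q_def sc \<phi>(2) \<phi>.diff scaleC_add_right scaleC_scaleC right_diff_distrib)
    moreover have PQ: "P (Q x) = P x" for x by (simp add: Q_def P.add sc id Pg)
    then have "Q (Q x) = Q x" for x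
      unfolding Q_def[of "Q x"] by (simp add: PQ) (simp add: Q_def \<phi>(2) \<phi>(3))
    moreover have "range Q = cspan (insert a S)"
    proof
      have PS: "P x \<in> cspan (insert a S)" for x
        using r complex_vector.span_mono[of S "insert a S"] by auto
      have "g \<in> cspan (insert a S)" unfolding g_def
        by (intro complex_vector.span_diff PS complex_vector.span_base) auto
      then show "range Q \<subseteq> cspan (insert a S)"
        unfolding Q_def by (auto intro!: complex_vector.span_add PS complex_vector.span_scale)
      show "cspan (insert a S) \<subseteq> range Q"
      proof
        fix x assume "x \<in> cspan (insert a S)"
        then obtain k where "x - k *\<^sub>C a \<in> cspan S" by (auto simp: complex_vector.span_insert)
        then obtain y where y: "x - k *\<^sub>C a = P y" using r by (metis imageE)
        have x: "x = P y + k *\<^sub>C a" using y by (simp add: algebra_simps)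
        have "x - P x = k *\<^sub>C g"
          by (simp add: x P.add id sc g_def complex_vector.scale_right_diff_distrib)
        then have "Q x = x" by (simp add: Q_def \<phi>(2,3)) (metis \<open>x - P x = k *\<^sub>C g\<close> add.commute diff_add_cancel)
        then show "x \<in> range Q" by (metis rangeI)
      qed
    qed
    ultimately show ?thesis unfolding bounded_clinear_def by blast
  qed
qed

lemma finite_cdim_basis:
  assumes V: "csubspace V" "finite_cdim V"
  obtains S where "finite S" "complex_vector.independent S" "cspan S = V"
proof -
  obtain B where B: "finite B" "V \<subseteq> cspan B" using V(2) by (auto simp: finite_cdim_def)
  obtain S where S: "S \<subseteq> V" "complex_vector.independent S" "V \<subseteq> cspan S"
    by (rule complex_vector.maximal_independent_subset)
  have "finite S" using complex_vector.independent_span_bound[OF B(1) S(2)] S B by auto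
  moreover have "cspan S = V" by (rule complex_vector.span_subspace[OF S(1,3) V(1)])
  ultimately show ?thesis using that S by blast
qed

lemma finite_cdim_complemented:
  assumes "csubspace V" "finite_cdim V"
  shows "complemented_in UNIV V"
  using finite_cdim_basis[OF assms] finite_span_range_projection complemented_range_projection by metis

lemma finite_cdim_mono: "V \<subseteq> W \<Longrightarrow> finite_cdim W \<Longrightarrow> finite_cdim V"
  unfolding finite_cdim_def by blast

text \<open>Exchange: if \<open>f\<close> occurs in an expression of \<open>v\<close> by elements of \<open>F\<close>, solve for \<open>f\<close>.\<close>

lemma dependent_removal:
  fixes v :: "'a::complex_normed_vector"
  assumes "finite F" "v \<in> cspan F" "v \<noteq> 0"
  shows "\<exists>f\<in>F. f \<in> cspan (insert v (F - {f}))"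
  using assms
proof (induction F)
  case (insert a F)
  show ?case
  proof (cases "v \<in> cspan F")
    case True
    then obtain f where f: "f \<in> F" "f \<in> cspan (insert v (F - {f}))" using insert by auto
    then have "f \<in> cspan (insert v (insert a F - {f}))"
      using complex_vector.span_mono[of "insert v (F - {f})" "insert v (insert a F - {f})"] by blast
    then show ?thesis using f by blast
  next
    case False
    then have "v \<notin> cspan (insert a F - {a})" using insert by simp
    from complex_vector.in_span_delete[OF insert.prems(1) this] show ?thesis by blast
  qed
qed simp

text \<open>A nonzero vector of \<open>V\<close> in the span of \<open>F\<close> would make an element of \<open>F\<close> superfluous.\<close>

lemma minimal_supplement_direct:
  fixes V :: "'a::complex_normed_vector set"
  assumes V: "csubspace V" and F: "finite F" "cspan (V \<union> F) = UNIV"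
    and min: "\<And>F'. finite F' \<Longrightarrow> cspan (V \<union> F') = UNIV \<Longrightarrow> card F \<le> card F'"
  shows "V \<inter> cspan F = {0}"
proof -
  have "v = 0" if v: "v \<in> V" "v \<in> cspan F" for v
  proof (rule ccontr)
    assume "v \<noteq> 0"
    then obtain f where f: "f \<in> F" "f \<in> cspan (insert v (F - {f}))"
      using dependent_removal[OF F(1) v(2)] by blast
    let ?F = "F - {f}"
    have "f \<in> cspan (V \<union> ?F)"
      using f(2) v(1) complex_vector.span_mono[of "insert v ?F" "V \<union> ?F"] by blast
    then have "V \<union> F \<subseteq> cspan (V \<union> ?F)"
      using complex_vector.span_superset[of "V \<union> ?F"] by blast
    then have "cspan (V \<union> F) \<subseteq> cspan (V \<union> ?F)"
      by (rule complex_vector.span_minimal) (rule complex_vector.subspace_span)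
    then have "card F \<le> card ?F" using F by (intro min) auto
    moreover have "card ?F < card F" using f F by (intro card_Diff1_less)
    ultimately show False by simp
  qed
  then show ?thesis using V by (auto simp: complex_vector.subspace_0 complex_vector.span_zero)
qed

lemma cspan_Un_subspace:
  fixes V :: "'a::complex_normed_vector set"
  assumes "csubspace V" shows "cspan (V \<union> F) = V + cspan F"
proof -
  have "cspan V = V" using assms by (rule complex_vector.span_eq_iff[THEN iffD2])
  then have "cspan (V \<union> F) = {x + y |x y. x \<in> V \<and> y \<in> cspan F}"
    by (simp only: complex_vector.span_Un)
  then show ?thesis by (auto simp: set_plus_def)
qed

text \<open>A finite set that together with \<open>U\<close> spans the space does so together with \<open>V\<close>; one of least
cardinality among the latter spans an algebraic complement of \<open>V\<close>.\<close>

lemma finite_ccodim_mono: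
  fixes U V :: "'a::complex_normed_vector set"
  assumes U: "csubspace U" and V: "csubspace V" and UV: "U \<subseteq> V" and fin: "finite_ccodim U"
  shows "finite_ccodim V"
proof -
  define P where "P c \<longleftrightarrow> (\<exists>F. finite F \<and> cspan (V \<union> F) = UNIV \<and> card F = c)" for c
  obtain W B where W: "algebraic_complement UNIV U W" "finite B" "W \<subseteq> cspan B"
    using fin by (auto simp: finite_ccodim_def finite_cdim_def)
  have "U + W \<subseteq> V + cspan B" using UV W(3) by (rule set_plus_mono2)
  then have "cspan (V \<union> B) = UNIV"
    using W(1) unfolding cspan_Un_subspace[OF V] algebraic_complement_def by auto
  then have "P (card B)" using W(2) unfolding P_def by blast
  then have "P (LEAST c. P c)" by (rule LeastI)
  then obtain F where F: "finite F" "cspan (V \<union> F) = UNIV" "card F = (LEAST c. P c)"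
    unfolding P_def[of "LEAST c. P c"] by blast
  have "card F \<le> card F'" if "finite F'" "cspan (V \<union> F') = UNIV" for F'
  proof -
    have "P (card F')" unfolding P_def using that by blast
    then show ?thesis unfolding F(3) by (rule Least_le)
  qed
  then have "V \<inter> cspan F = {0}" by (rule minimal_supplement_direct[OF V F(1,2)])
  then have "algebraic_complement UNIV V (cspan F)"
    using V F(2) unfolding algebraic_complement_def cspan_Un_subspace[OF V]
    by (simp add: complex_vector.subspace_span)
  moreover have "finite_cdim (cspan F)" using F(1) by (auto simp: finite_cdim_def)
  ultimately show ?thesis unfolding finite_ccodim_def by blast
qed

section \<open>The chains of a linear operator\<close>

definition ran_plus_ker :: "('a::complex_normed_vector \<Rightarrow> 'a) \<Rightarrow> nat \<Rightarrow> 'a set" where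
  "ran_plus_ker T n = range T + ker (T ^^ n)"

definition ker_cap_ran :: "('a::complex_normed_vector \<Rightarrow> 'a) \<Rightarrow> nat \<Rightarrow> 'a set" where
  "ker_cap_ran T n = ker T \<inter> range (T ^^ n)"

definition stable_from :: "('a::complex_normed_vector \<Rightarrow> 'a) \<Rightarrow> nat \<Rightarrow> bool" where
  "stable_from T n \<longleftrightarrow> (\<forall>m\<ge>n. ker_cap_ran T m = ker_cap_ran T n)"

lemma mem_ker_cap_ran: "x \<in> ker_cap_ran T n \<longleftrightarrow> T x = 0 \<and> (\<exists>y. x = (T ^^ n) y)"
  by (auto simp: ker_cap_ran_def ker_on_def)

lemma mem_ran_plus_ker: "x \<in> ran_plus_ker T n \<longleftrightarrow> (\<exists>y z. x = T y + z \<and> (T ^^ n) z = 0)"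
  by (auto simp: ran_plus_ker_def ker_on_def set_plus_def)

lemma bounded_clinear_pow: "bounded_clinear T \<Longrightarrow> bounded_clinear (T ^^ n)"
proof (induction n)
  case 0 then show ?case by (simp add: bounded_clinear_def bounded_linear_ident id_def)
next
  case (Suc n)
  then show ?case
    by (auto simp: bounded_clinear_def comp_def intro: bounded_linear_compose)
qed

lemma bounded_clinearD:
  assumes "bounded_clinear T"
  shows "bounded_linear T" "T (c *\<^sub>C x) = c *\<^sub>C T x" "T 0 = 0" "T (x + y) = T x + T y"
    "T (x - y) = T x - T y"
proof -
  show bl: "bounded_linear T" and "T (c *\<^sub>C x) = c *\<^sub>C T x"
    using assms by (auto simp: bounded_clinear_def)
  interpret bounded_linear T by fact
  show "T 0 = 0" "T (x + y) = T x + T y" "T (x - y) = T x - T y"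
    by (rule zero add diff)+
qed

lemmas pow_linear = bounded_clinearD[OF bounded_clinear_pow]

lemma csubspace_image:
  assumes "bounded_clinear T" "csubspace V" shows "csubspace (T ` V)"
  unfolding complex_vector.subspace_def
proof (intro conjI ballI allI)
  note V = complex_vector.subspace_0[OF assms(2)] complex_vector.subspace_add[OF assms(2)]
    complex_vector.subspace_scale[OF assms(2)]
  note T = bounded_clinearD[OF assms(1)]
  show "0 \<in> T ` V" using T(3) V(1) by (metis imageI)
  show "x + y \<in> T ` V" if xy: "x \<in> T ` V" "y \<in> T ` V" for x y
  proof -
    obtain v w where "v \<in> V" "w \<in> V" "x = T v" "y = T w" using xy by blast
    then show ?thesis using T(4)[of v w] V(2)[of v w] by (metis imageI)
  qed
  show "c *\<^sub>C x \<in> T ` V" if x: "x \<in> T ` V" for c x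
  proof -
    obtain v where "v \<in> V" "x = T v" using x by blast
    then show ?thesis using T(2)[of c v] V(3)[of v c] by (metis imageI)
  qed
qed

lemma csubspace_range: "bounded_clinear T \<Longrightarrow> csubspace (range T)"
  by (rule csubspace_image) (auto simp: complex_vector.subspace_UNIV)

lemma csubspace_ker: "bounded_clinear T \<Longrightarrow> csubspace (ker T)"
  by (auto simp: complex_vector.subspace_def ker_on_def bounded_clinearD)

lemma csubspace_plus:
  assumes "csubspace V" "csubspace W" shows "csubspace (V + W)"
proof -
  have "V + W = {x + y |x y. x \<in> V \<and> y \<in> W}" by (auto simp: set_plus_def)
  then show ?thesis using complex_vector.subspace_sums[OF assms] by (simp only:)
qed

lemma csubspace_ran_plus_ker: "bounded_clinear T \<Longrightarrow> csubspace (ran_plus_ker T n)"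
  unfolding ran_plus_ker_def by (intro csubspace_plus csubspace_range csubspace_ker bounded_clinear_pow)

lemma csubspace_ker_cap_ran: "bounded_clinear T \<Longrightarrow> csubspace (ker_cap_ran T n)"
  unfolding ker_cap_ran_def
  by (intro complex_vector.subspace_inter csubspace_range csubspace_ker bounded_clinear_pow)

lemma pow_add_apply: "(T ^^ (m + n)) x = (T ^^ m) ((T ^^ n) x)"
  by (simp add: funpow_add)

lemma pow_zero_mono:
  assumes "bounded_clinear T" "(T ^^ m) x = 0" "m \<le> n" shows "(T ^^ n) x = 0"
proof -
  have "(T ^^ n) x = (T ^^ (n - m)) ((T ^^ m) x)" using assms(3) by (simp flip: pow_add_apply)
  then show ?thesis using assms pow_linear(3) by simp
qed

lemma range_pow_antimono: "m \<le> n \<Longrightarrow> range ((T :: 'a \<Rightarrow> 'a) ^^ n) \<subseteq> range (T ^^ m)"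
proof
  fix x :: 'a assume mn: "m \<le> n" and "x \<in> range (T ^^ n)"
  then obtain y where "x = (T ^^ n) y" by auto
  also have "\<dots> = (T ^^ m) ((T ^^ (n - m)) y)" using mn by (simp flip: pow_add_apply)
  finally show "x \<in> range (T ^^ m)" by simp
qed

lemma ker_cap_ran_antimono: "m \<le> n \<Longrightarrow> ker_cap_ran T n \<subseteq> ker_cap_ran T m"
  unfolding ker_cap_ran_def using range_pow_antimono[of m n T] by blast

lemma ran_plus_ker_mono: "bounded_clinear T \<Longrightarrow> m \<le> n \<Longrightarrow> ran_plus_ker T m \<subseteq> ran_plus_ker T n"
  unfolding ran_plus_ker_def ker_on_def using pow_zero_mono[of T m _ n] by (intro set_plus_mono2) auto

text \<open>Both equations say that every \<open>x\<close> with \<open>T\<^bsup>n+1\<^esup> x = 0\<close> satisfies \<open>T\<^sup>n x = T\<^bsup>n+1\<^esup> y\<close> for some \<open>y\<close>: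
the elements of \<open>ker T \<inter> range (T ^^ n)\<close> are the \<open>T\<^sup>n x\<close>, and \<open>T\<^sup>n x = T\<^bsup>n+1\<^esup> y\<close> means that
\<open>x - T y\<close> is in the kernel of \<open>T\<^sup>n\<close>.\<close>

lemma stage_step_equivalence:
  assumes T: "bounded_clinear T"
  shows "ker_cap_ran T n = ker_cap_ran T (Suc n) \<longleftrightarrow> ran_plus_ker T n = ran_plus_ker T (Suc n)"
proof
  assume eq: "ker_cap_ran T n = ker_cap_ran T (Suc n)"
  have "x \<in> ran_plus_ker T n" if "(T ^^ Suc n) x = 0" for x
  proof -
    have "(T ^^ n) x \<in> ker_cap_ran T n" using that by (auto simp: mem_ker_cap_ran)
    then obtain y where "(T ^^ n) x = (T ^^ Suc n) y" unfolding eq by (auto simp: mem_ker_cap_ran)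
    then have "(T ^^ n) (x - T y) = 0" by (simp add: pow_linear[OF T] funpow_swap1)
    then show ?thesis unfolding mem_ran_plus_ker by (intro exI[of _ y] exI[of _ "x - T y"]) simp
  qed
  then have "ker (T ^^ Suc n) \<subseteq> ran_plus_ker T n" by (auto simp: ker_on_def)
  moreover have "range T \<subseteq> ran_plus_ker T n"
  proof
    fix x assume "x \<in> range T"
    then obtain y where "x = T y + 0" by auto
    then show "x \<in> ran_plus_ker T n" unfolding mem_ran_plus_ker using pow_linear(3)[OF T] by blast
  qed
  ultimately have "ran_plus_ker T (Suc n) \<subseteq> ran_plus_ker T n"
    using csubspace_ran_plus_ker[OF T, of n] unfolding ran_plus_ker_def[of T "Suc n"]
    by (auto elim!: set_plus_elim intro!: complex_vector.subspace_add)
  then show "ran_plus_ker T n = ran_plus_ker T (Suc n)" using ran_plus_ker_mono[OF T, of n "Suc n"] by auto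
next
  assume eq: "ran_plus_ker T n = ran_plus_ker T (Suc n)"
  have "ker_cap_ran T n \<subseteq> ker_cap_ran T (Suc n)"
  proof
    fix x assume "x \<in> ker_cap_ran T n"
    then obtain y where y: "x = (T ^^ n) y" "T x = 0" by (auto simp: mem_ker_cap_ran)
    have "y = T 0 + y" "(T ^^ Suc n) y = 0" using y bounded_clinearD(3)[OF T] by simp_all
    then have "y \<in> ran_plus_ker T (Suc n)" unfolding mem_ran_plus_ker by blast
    then obtain u z where "y = T u + z" "(T ^^ n) z = 0" unfolding eq[symmetric] by (auto simp: mem_ran_plus_ker)
    then have "x = (T ^^ Suc n) u" using y by (simp add: pow_linear[OF T] funpow_swap1)
    then show "x \<in> ker_cap_ran T (Suc n)" using y by (auto simp: mem_ker_cap_ran)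
  qed
  then show "ker_cap_ran T n = ker_cap_ran T (Suc n)" using ker_cap_ran_antimono[of n "Suc n" T] by auto
qed

lemma eventually_constant_iff_steps:
  "(\<forall>m\<ge>n. f m = f n) \<longleftrightarrow> (\<forall>m\<ge>n::nat. f m = f (Suc m))"
proof
  assume h: "\<forall>m\<ge>n. f m = f (Suc m)"
  have "f m = f n" if "m \<ge> n" for m
    using that
  proof (induction rule: dec_induct)
    case (step k)
    then show ?case using h[rule_format, of k] by (simp only:)
  qed (rule refl)
  then show "\<forall>m\<ge>n. f m = f n" by blast
next
  assume h: "\<forall>m\<ge>n. f m = f n"
  show "\<forall>m\<ge>n. f m = f (Suc m)"
  proof (intro allI impI)
    fix m assume m: "n \<le> m"
    show "f m = f (Suc m)" using h[rule_format, OF m] h[rule_format, OF le_SucI[OF m]] by (simp only:)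
  qed
qed

lemma stable_from_iff_ran_plus_ker:
  assumes "bounded_clinear T" shows "stable_from T n \<longleftrightarrow> (\<forall>m\<ge>n. ran_plus_ker T m = ran_plus_ker T n)"
  unfolding stable_from_def eventually_constant_iff_steps[of n "ker_cap_ran T"]
    eventually_constant_iff_steps[of n "ran_plus_ker T"] stage_step_equivalence[OF assms] ..

lemma stable_ker_cap_ran: "stable_from T n \<Longrightarrow> n \<le> m \<Longrightarrow> ker_cap_ran T m = ker_cap_ran T n"
  unfolding stable_from_def by blast

lemma stable_ran_plus_ker: "bounded_clinear T \<Longrightarrow> stable_from T n \<Longrightarrow> n \<le> m \<Longrightarrow> ran_plus_ker T m = ran_plus_ker T n"
  using stable_from_iff_ran_plus_ker by blast

lemma stable_unique:
  assumes T: "bounded_clinear T" and n: "stable_from T n" and m: "stable_from T m"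
  shows "ker_cap_ran T n = ker_cap_ran T m" "ran_plus_ker T n = ran_plus_ker T m"
  using stable_ker_cap_ran[OF n, of "max n m"] stable_ker_cap_ran[OF m, of "max n m"]
    stable_ran_plus_ker[OF T n, of "max n m"] stable_ran_plus_ker[OF T m, of "max n m"] by simp_all

lemma Inf_enat_image: "n \<in> A \<Longrightarrow> \<exists>m\<in>A. m \<le> n \<and> Inf (enat ` A) = enat m"
proof (intro bexI conjI)
  assume n: "n \<in> A"
  let ?m = "LEAST m. m \<in> A"
  show m: "?m \<in> A" using n by (rule LeastI)
  show "?m \<le> n" using n by (rule Least_le)
  show "Inf (enat ` A) = enat ?m"
    by (rule antisym) (use m in \<open>auto intro!: Inf_lower Inf_greatest Least_le\<close>)
qed

lemma Inf_enat_image_mem: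
  assumes eq: "Inf (enat ` A) = enat m" shows "m \<in> A"
proof -
  have "A \<noteq> {}" using eq by (auto simp: top_enat_def)
  then obtain n where "n \<in> A" by blast
  from Inf_enat_image[OF this] obtain k where "k \<in> A" "Inf (enat ` A) = enat k" by blast
  then show ?thesis using eq by simp
qed

text \<open>The definition of \<open>dis\<close> ranges over \<open>m \<ge> 1\<close> only, but the excluded equation, the one for
\<open>n = m = 0\<close>, is trivial.\<close>

lemma dis_stable:
  shows "dis T = enat d \<Longrightarrow> stable_from T d" and "stable_from T n \<Longrightarrow> \<exists>d. dis T = enat d"
proof -
  have eq: "{n. \<forall>m. m \<ge> n \<longrightarrow> m \<ge> 1 \<longrightarrow> ker T \<inter> range (T ^^ n) = ker T \<inter> range (T ^^ m)}
      = {n. stable_from T n}" (is "?A = _")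
  proof (intro set_eqI iffI)
    fix n assume "n \<in> ?A"
    then have h: "ker_cap_ran T m = ker_cap_ran T n" if "m \<ge> n" "m \<ge> 1" for m using that by (auto simp: ker_cap_ran_def)
    have "ker_cap_ran T m = ker_cap_ran T n" if "m \<ge> n" for m
      using h that by (cases "m = 0") auto
    then show "n \<in> {n. stable_from T n}" unfolding stable_from_def by blast
  next
    fix n assume "n \<in> {n. stable_from T n}"
    then show "n \<in> ?A" unfolding stable_from_def ker_cap_ran_def mem_Collect_eq by metis
  qed
  show "dis T = enat d \<Longrightarrow> stable_from T d" unfolding dis_def eq using Inf_enat_image_mem by blast
  show "stable_from T n \<Longrightarrow> \<exists>d. dis T = enat d" unfolding dis_def eq using Inf_enat_image by blast
qed

lemma ascent_condition:
  assumes T: "bounded_clinear T"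
  shows "ker (T ^^ n) = ker (T ^^ Suc n) \<longleftrightarrow> ker_cap_ran T n = {0}"
proof
  assume eq: "ker (T ^^ n) = ker (T ^^ Suc n)"
  have "x = 0" if "x \<in> ker_cap_ran T n" for x
  proof -
    obtain y where y: "x = (T ^^ n) y" "T x = 0" using \<open>x \<in> ker_cap_ran T n\<close> by (auto simp: mem_ker_cap_ran)
    then have "y \<in> ker (T ^^ Suc n)" by (simp add: ker_on_def)
    then show ?thesis using y unfolding eq[symmetric] by (simp add: ker_on_def)
  qed
  then show "ker_cap_ran T n = {0}" using complex_vector.subspace_0[OF csubspace_ker_cap_ran[OF T]] by blast
next
  assume eq: "ker_cap_ran T n = {0}"
  have "(T ^^ n) x = 0" if "(T ^^ Suc n) x = 0" for x
  proof -
    have "(T ^^ n) x \<in> ker_cap_ran T n" using that by (auto simp: mem_ker_cap_ran)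
    then show ?thesis using eq by simp
  qed
  then show "ker (T ^^ n) = ker (T ^^ Suc n)"
    by (auto simp: ker_on_def bounded_clinearD[OF T])
qed

lemma descent_condition:
  assumes T: "bounded_clinear T"
  shows "range (T ^^ n) = range (T ^^ Suc n) \<longleftrightarrow> ran_plus_ker T n = UNIV"
proof
  assume eq: "range (T ^^ n) = range (T ^^ Suc n)"
  have "x \<in> ran_plus_ker T n" for x
  proof -
    have "(T ^^ n) x \<in> range (T ^^ Suc n)" unfolding eq[symmetric] by simp
    then obtain y where "(T ^^ n) x = (T ^^ Suc n) y" by blast
    then have "(T ^^ n) (x - T y) = 0" by (simp add: pow_linear[OF T] funpow_swap1)
    then show ?thesis unfolding mem_ran_plus_ker by (intro exI[of _ y] exI[of _ "x - T y"]) simp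
  qed
  then show "ran_plus_ker T n = UNIV" by blast
next
  assume eq: "ran_plus_ker T n = UNIV"
  have "range (T ^^ n) \<subseteq> range (T ^^ Suc n)"
  proof (rule image_subsetI)
    fix x
    have "x \<in> ran_plus_ker T n" using eq by simp
    then obtain u z where "x = T u + z" "(T ^^ n) z = 0" by (auto simp: mem_ran_plus_ker)
    then have "(T ^^ n) x = (T ^^ Suc n) u" by (simp add: pow_linear[OF T] funpow_swap1)
    then show "(T ^^ n) x \<in> range (T ^^ Suc n)" by (simp only: rangeI)
  qed
  then show "range (T ^^ n) = range (T ^^ Suc n)"
    using range_pow_antimono[of n "Suc n" T] by (simp only: antisym le_SucI order_refl)
qed

lemma trivial_ker_cap_ran_stable:
  assumes T: "bounded_clinear T" and "ker_cap_ran T n = {0}" shows "stable_from T n"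
  unfolding stable_from_def
proof (intro allI impI)
  fix m assume "n \<le> m"
  then have "ker_cap_ran T m \<subseteq> {0}" using ker_cap_ran_antimono[of n m T] assms(2) by simp
  then show "ker_cap_ran T m = ker_cap_ran T n"
    using complex_vector.subspace_0[OF csubspace_ker_cap_ran[OF T, of m]] assms(2) by auto
qed

lemma total_ran_plus_ker_stable:
  assumes T: "bounded_clinear T" and "ran_plus_ker T n = UNIV" shows "stable_from T n"
  unfolding stable_from_iff_ran_plus_ker[OF T] 
proof (intro allI impI)
  fix m assume "n \<le> m"
  then show "ran_plus_ker T m = ran_plus_ker T n" using ran_plus_ker_mono[OF T, of n m] assms(2) by auto
qed

text \<open>The four characterisations below replace the particular index in each definition by any index from
which on the chains are constant. This is possible because the chains take the same values at all
such indices.\<close>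

lemma left_drazin_iff:
  assumes T: "bounded_clinear T"
  shows "left_drazin T \<longleftrightarrow> (\<exists>n. stable_from T n \<and> ker_cap_ran T n = {0} \<and> complemented_in UNIV (ran_plus_ker T n))"
proof
  assume "left_drazin T"
  then obtain p where p: "ascent T = enat p" "complemented_in UNIV (ran_plus_ker T p)"
    by (auto simp: left_drazin_def ran_plus_ker_def)
  then have "ker_cap_ran T p = {0}"
    using Inf_enat_image_mem[OF p(1)[unfolded ascent_def]] ascent_condition[OF T] by blast
  then show "\<exists>n. stable_from T n \<and> ker_cap_ran T n = {0} \<and> complemented_in UNIV (ran_plus_ker T n)"
    using trivial_ker_cap_ran_stable[OF T] p(2) by blast
next
  assume "\<exists>n. stable_from T n \<and> ker_cap_ran T n = {0} \<and> complemented_in UNIV (ran_plus_ker T n)"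
  then obtain n where n: "stable_from T n" "ker_cap_ran T n = {0}" "complemented_in UNIV (ran_plus_ker T n)" by blast
  have "n \<in> {n. ker (T ^^ n) = ker (T ^^ Suc n)}" using n(2) unfolding ascent_condition[OF T] by simp
  from Inf_enat_image[OF this] obtain p where p: "ker_cap_ran T p = {0}" "ascent T = enat p"
    unfolding ascent_def ascent_condition[OF T] by auto
  have "ran_plus_ker T p = ran_plus_ker T n" by (rule stable_unique(2)[OF T trivial_ker_cap_ran_stable[OF T p(1)] n(1)])
  then show "left_drazin T" using p(2) n(3) unfolding left_drazin_def ran_plus_ker_def by metis
qed

lemma right_drazin_iff:
  assumes T: "bounded_clinear T"
  shows "right_drazin T \<longleftrightarrow> (\<exists>n. stable_from T n \<and> ran_plus_ker T n = UNIV \<and> complemented_in UNIV (ker_cap_ran T n))"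
proof
  assume "right_drazin T"
  then obtain q where q: "descent T = enat q" "complemented_in UNIV (ker_cap_ran T q)"
    by (auto simp: right_drazin_def ker_cap_ran_def)
  then have "ran_plus_ker T q = UNIV"
    using Inf_enat_image_mem[OF q(1)[unfolded descent_def]] descent_condition[OF T] by blast
  then show "\<exists>n. stable_from T n \<and> ran_plus_ker T n = UNIV \<and> complemented_in UNIV (ker_cap_ran T n)"
    using total_ran_plus_ker_stable[OF T] q(2) by blast
next
  assume "\<exists>n. stable_from T n \<and> ran_plus_ker T n = UNIV \<and> complemented_in UNIV (ker_cap_ran T n)"
  then obtain n where n: "stable_from T n" "ran_plus_ker T n = UNIV" "complemented_in UNIV (ker_cap_ran T n)" by blast
  have "n \<in> {n. range (T ^^ n) = range (T ^^ Suc n)}"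
    using n(2) unfolding descent_condition[OF T] by simp
  from Inf_enat_image[OF this] obtain q where q: "ran_plus_ker T q = UNIV" "descent T = enat q"
    unfolding descent_def descent_condition[OF T] by auto
  have "ker_cap_ran T q = ker_cap_ran T n" by (rule stable_unique(1)[OF T total_ran_plus_ker_stable[OF T q(1)] n(1)])
  then show "right_drazin T" using q(2) n(3) unfolding right_drazin_def ker_cap_ran_def by metis
qed

lemma Inf_enat_finite_iff: "Inf (enat ` A) < \<infinity> \<longleftrightarrow> A \<noteq> {}"
proof (cases "A = {}")
  case False
  then obtain n where "n \<in> A" by blast
  from Inf_enat_image[OF this] show ?thesis using False by auto
qed (simp add: top_enat_def)

lemma ess_left_drazin_iff:
  assumes T: "bounded_clinear T"
  shows "ess_left_drazin T \<longleftrightarrow>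
    (\<exists>n. stable_from T n \<and> finite_cdim (ker_cap_ran T n) \<and> complemented_in UNIV (ran_plus_ker T n))"
proof
  assume "ess_left_drazin T"
  then obtain d k where d: "dis T = enat d" "complemented_in UNIV (ran_plus_ker T d)" "finite_cdim (ker_cap_ran T k)"
    unfolding ess_left_drazin_def ess_ascent_def Inf_enat_finite_iff ran_plus_ker_def ker_cap_ran_def by blast
  have st: "stable_from T d" by (rule dis_stable(1)[OF d(1)])
  have "ker_cap_ran T (max d k) \<subseteq> ker_cap_ran T k" by (rule ker_cap_ran_antimono) simp
  then have "finite_cdim (ker_cap_ran T (max d k))" using d(3) finite_cdim_mono by blast
  moreover have "ker_cap_ran T (max d k) = ker_cap_ran T d" by (rule stable_ker_cap_ran[OF st]) simp
  ultimately show "\<exists>n. stable_from T n \<and> finite_cdim (ker_cap_ran T n) \<and> complemented_in UNIV (ran_plus_ker T n)"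
    using st d(2) by auto
next
  assume "\<exists>n. stable_from T n \<and> finite_cdim (ker_cap_ran T n) \<and> complemented_in UNIV (ran_plus_ker T n)"
  then obtain n where n: "stable_from T n" "finite_cdim (ker_cap_ran T n)" "complemented_in UNIV (ran_plus_ker T n)" by blast
  obtain d where d: "dis T = enat d" using dis_stable(2)[OF n(1)] by blast
  have "ran_plus_ker T d = ran_plus_ker T n" by (rule stable_unique(2)[OF T dis_stable(1)[OF d] n(1)])
  then have "complemented_in UNIV (range T + ker (T ^^ d))" using n(3) unfolding ran_plus_ker_def by metis
  then show "ess_left_drazin T"
    using d n(2) unfolding ess_left_drazin_def ess_ascent_def Inf_enat_finite_iff ker_cap_ran_def by blast
qed

lemma ess_right_drazin_iff:
  assumes T: "bounded_clinear T"
  shows "ess_right_drazin T \<longleftrightarrow>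
    (\<exists>n. stable_from T n \<and> finite_ccodim (ran_plus_ker T n) \<and> complemented_in UNIV (ker_cap_ran T n))"
proof
  assume "ess_right_drazin T"
  then obtain d k where d: "dis T = enat d" "complemented_in UNIV (ker_cap_ran T d)" "finite_ccodim (ran_plus_ker T k)"
    unfolding ess_right_drazin_def ess_descent_def Inf_enat_finite_iff ran_plus_ker_def ker_cap_ran_def by blast
  have st: "stable_from T d" by (rule dis_stable(1)[OF d(1)])
  have "finite_ccodim (ran_plus_ker T (max d k))"
    by (rule finite_ccodim_mono[OF csubspace_ran_plus_ker[OF T] csubspace_ran_plus_ker[OF T] ran_plus_ker_mono[OF T] d(3)]) simp
  moreover have "ran_plus_ker T (max d k) = ran_plus_ker T d" by (rule stable_ran_plus_ker[OF T st]) simp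
  ultimately show "\<exists>n. stable_from T n \<and> finite_ccodim (ran_plus_ker T n) \<and> complemented_in UNIV (ker_cap_ran T n)"
    using st d(2) by auto
next
  assume "\<exists>n. stable_from T n \<and> finite_ccodim (ran_plus_ker T n) \<and> complemented_in UNIV (ker_cap_ran T n)"
  then obtain n where n: "stable_from T n" "finite_ccodim (ran_plus_ker T n)" "complemented_in UNIV (ker_cap_ran T n)" by blast
  obtain d where d: "dis T = enat d" using dis_stable(2)[OF n(1)] by blast
  have "ker_cap_ran T d = ker_cap_ran T n" by (rule stable_unique(1)[OF T dis_stable(1)[OF d] n(1)])
  then have "complemented_in UNIV (ker T \<inter> range (T ^^ d))" using n(3) unfolding ker_cap_ran_def by metis
  then show "ess_right_drazin T"
    using d n(2) unfolding ess_right_drazin_def ess_descent_def Inf_enat_finite_iff ran_plus_ker_def by blast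
qed

section \<open>Construction of the Saphar decomposition\<close>

lemma apply_in_ran_plus_ker: "bounded_clinear T \<Longrightarrow> T y \<in> ran_plus_ker T n"
  unfolding mem_ran_plus_ker by (intro exI[of _ y] exI[of _ 0]) (simp add: pow_linear(3))

lemma ker_pow_subset_ran_plus_ker:
  assumes T: "bounded_clinear T" and st: "stable_from T n" and x: "(T ^^ j) x = 0"
  shows "x \<in> ran_plus_ker T n"
proof -
  have "(T ^^ max n j) x = 0" by (rule pow_zero_mono[OF T x]) simp
  then have "x \<in> ran_plus_ker T (max n j)"
    unfolding mem_ran_plus_ker by (intro exI[of _ 0] exI[of _ x]) (simp add: bounded_clinearD(3)[OF T])
  also have "ran_plus_ker T (max n j) = ran_plus_ker T n" by (rule stable_ran_plus_ker[OF T st]) simp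
  finally show ?thesis .
qed

text \<open>Induction on \<open>j\<close>: \<open>T\<^bsup>j\<^esup> x\<close> lies in \<open>ker T \<inter> range (T ^^ (j + n))\<close>, which by stability is
contained in the range of \<open>T\<^bsup>j+n+m\<^esup>\<close>. Subtracting a suitable \<open>T\<^bsup>n+m\<^esup> u\<close> from \<open>x\<close> gives an element
of the range of \<open>T\<^sup>n\<close> that is killed by \<open>T\<^bsup>j\<^esup>\<close>.\<close>

lemma generalized_kernel_deep_range:
  assumes T: "bounded_clinear T" and st: "stable_from T n"
    and "(T ^^ j) x = 0" "x \<in> range (T ^^ n)"
  shows "x \<in> range (T ^^ m)"
  using assms(3,4)
proof (induction j arbitrary: x)
  case 0
  then have "x = (T ^^ m) 0" by (simp add: pow_linear(3)[OF T])
  then show ?case by (rule range_eqI)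
next
  case (Suc j)
  then obtain y where y: "x = (T ^^ n) y" by blast
  have "T ((T ^^ j) x) = 0" using Suc.prems(1) by simp
  moreover have "(T ^^ j) x = (T ^^ (j + n)) y" using y by (simp add: pow_add_apply)
  ultimately have "(T ^^ j) x \<in> ker_cap_ran T (j + n)" unfolding mem_ker_cap_ran by blast
  also have "ker_cap_ran T (j + n) = ker_cap_ran T n" by (rule stable_ker_cap_ran[OF st]) simp
  also have "\<dots> = ker_cap_ran T (j + (n + m))" by (rule stable_ker_cap_ran[OF st, symmetric]) simp
  finally obtain u where "(T ^^ j) x = (T ^^ (j + (n + m))) u" unfolding mem_ker_cap_ran by blast
  then have "(T ^^ j) (x - (T ^^ (n + m)) u) = 0"
    by (simp add: pow_linear(5)[OF T] pow_add_apply[of j])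
  moreover have "x - (T ^^ (n + m)) u = (T ^^ n) (y - (T ^^ m) u)"
    using y by (simp add: pow_linear(5)[OF T] pow_add_apply)
  ultimately have "x - (T ^^ (n + m)) u \<in> range (T ^^ m)" using Suc.IH by blast
  moreover have "(T ^^ (n + m)) u \<in> range (T ^^ m)"
    using range_pow_antimono[of m "n + m" T] by auto
  ultimately have "x - (T ^^ (n + m)) u + (T ^^ (n + m)) u \<in> range (T ^^ m)"
    by (rule complex_vector.subspace_add[OF csubspace_range[OF bounded_clinear_pow[OF T]]])
  then show ?case by simp
qed

text \<open>The space \<open>W + T W + \<dots> + T\<^bsup>k-1\<^esup> W + T\<^sup>k X\<close>. For \<open>W\<close> a complement of the limit of the increasing
chain, \<open>W\<close> plays the role of a space of generators: the terms \<open>T\<^sup>i W\<close> carry the part of \<open>X\<close> on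
which \<open>T\<close> behaves like a shift.\<close>

primrec shift_space :: "('a::complex_normed_vector \<Rightarrow> 'a) \<Rightarrow> 'a set \<Rightarrow> nat \<Rightarrow> 'a set" where
  "shift_space T W 0 = UNIV"
| "shift_space T W (Suc k) = W + T ` shift_space T W k"

lemma csubspace_shift_space:
  assumes "bounded_clinear T" "csubspace W" shows "csubspace (shift_space T W k)"
  using assms
  by (induction k) (simp_all add: complex_vector.subspace_UNIV csubspace_plus csubspace_image)

lemma operator_range_shift_space:
  fixes T :: "'a::complex_banach \<Rightarrow> 'a"
  assumes "bounded_clinear T" "csubspace W" "closed W"
  shows "operator_range (shift_space T W k)"
proof (induction k)
  case 0
  show ?case by (simp add: operator_range_closed_subspace)
next
  case (Suc k)
  have "operator_range W"
    by (rule operator_range_closed_subspace[OF assms(3) csubspace_subspace[OF assms(2)]])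
  then show ?case
    using Suc operator_range_image[OF bounded_clinearD(1)[OF assms(1)]]
    by (simp add: operator_range_plus)
qed

lemma shift_space_decreasing: "shift_space T W (Suc k) \<subseteq> shift_space T W k"
proof (induction k)
  case (Suc k)
  have "W + T ` shift_space T W (Suc k) \<subseteq> W + T ` shift_space T W k"
    by (rule set_plus_mono2[OF subset_refl image_mono[OF Suc]])
  then show ?case by simp
qed simp

lemma image_shift_space_Suc:
  assumes "csubspace W" shows "T ` shift_space T W k \<subseteq> shift_space T W (Suc k)"
proof
  fix x assume "x \<in> T ` shift_space T W k"
  from set_plus_intro[OF complex_vector.subspace_0[OF assms] this]
  show "x \<in> shift_space T W (Suc k)" by simp
qed

lemma range_pow_subset_shift_space:
  assumes "csubspace W" shows "range (T ^^ k) \<subseteq> shift_space T W k"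
proof (induction k)
  case (Suc k)
  have "range (T ^^ Suc k) = T ` range (T ^^ k)" by (auto simp: image_comp)
  also have "\<dots> \<subseteq> T ` shift_space T W k" by (rule image_mono[OF Suc])
  also have "\<dots> \<subseteq> shift_space T W (Suc k)" by (rule image_shift_space_Suc[OF assms])
  finally show ?case .
qed simp

text \<open>Iterate \<open>X = W + T X + ker(T\<^sup>n)\<close>, using that \<open>T\<close> maps \<open>ker(T\<^sup>n)\<close> into itself.\<close>

lemma shift_space_plus_ker:
  assumes T: "bounded_clinear T" and W: "algebraic_complement UNIV (ran_plus_ker T n) W"
  shows "\<exists>m z. x = m + z \<and> m \<in> shift_space T W k \<and> (T ^^ n) z = 0"
proof (induction k arbitrary: x)
  case 0
  show ?case by (rule exI[of _ x], rule exI[of _ 0]) (simp add: pow_linear(3)[OF T])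
next
  case (Suc k)
  have "x \<in> ran_plus_ker T n + W" using W by (simp add: algebraic_complement_def)
  then obtain a w where a: "a \<in> ran_plus_ker T n" "w \<in> W" "x = a + w" by (rule set_plus_elim)
  then obtain y z where y: "a = T y + z" "(T ^^ n) z = 0" by (auto simp: mem_ran_plus_ker)
  obtain m z' where m: "y = m + z'" "m \<in> shift_space T W k" "(T ^^ n) z' = 0" using Suc by blast
  have "x = (w + T m) + (T z' + z)"
    using a y m by (simp add: bounded_clinearD(4)[OF T])
  moreover have "w + T m \<in> shift_space T W (Suc k)"
    using a m by (simp add: set_plus_intro)
  moreover have "(T ^^ n) (T z' + z) = 0"
    using y m by (simp add: pow_linear(4)[OF T] funpow_swap1[symmetric] bounded_clinearD(3)[OF T])
  ultimately show ?case by blast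
qed

text \<open>Write \<open>x = w + T m\<close>. By stability \<open>ker(T\<^bsup>j\<^esup>) \<subseteq> ran(T) + ker(T\<^sup>n)\<close>, so \<open>w\<close> is zero. Then \<open>m\<close> is killed
by \<open>T\<^bsup>j+1\<^esup>\<close> and lies in the shift space with one step less.\<close>

lemma ker_pow_Int_shift_space:
  assumes T: "bounded_clinear T" and st: "stable_from T n"
    and W: "algebraic_complement UNIV (ran_plus_ker T n) W"
    and x: "x \<in> shift_space T W k" "(T ^^ j) x = 0"
  shows "x \<in> range (T ^^ k)"
  using x
proof (induction k arbitrary: x j)
  case (Suc k)
  then obtain w m where w: "w \<in> W" "m \<in> shift_space T W k" "x = w + T m"
    by (auto elim!: set_plus_elim)
  have "x \<in> ran_plus_ker T n" by (rule ker_pow_subset_ran_plus_ker[OF T st Suc.prems(2)])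
  moreover have "T m \<in> ran_plus_ker T n" by (rule apply_in_ran_plus_ker[OF T])
  ultimately have "x - T m \<in> ran_plus_ker T n" by (rule complex_vector.subspace_diff[OF csubspace_ran_plus_ker[OF T]])
  then have "w = 0" using w W by (auto simp: algebraic_complement_def)
  then have xm: "x = T m" using w by simp
  have "(T ^^ Suc j) m = 0" using Suc.prems(2) xm by (simp add: funpow_swap1)
  then obtain y where "m = (T ^^ k) y" using Suc.IH w(2) by blast
  then have "x = (T ^^ Suc k) y" using xm by simp
  then show ?case by (rule range_eqI)
qed simp

text \<open>Modulo the shift space of \<open>n + 1\<close> steps an element of the shift space of \<open>n\<close> steps is in
\<open>ker(T\<^sup>n)\<close>, hence in \<open>ker(T\<^sup>n) \<inter> ran(T\<^sup>n)\<close>, and this intersection is contained in the range of every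
power of \<open>T\<close>.\<close>

lemma shift_space_stationary:
  assumes T: "bounded_clinear T" and st: "stable_from T n"
    and W: "algebraic_complement UNIV (ran_plus_ker T n) W"
  shows "shift_space T W (Suc n) = shift_space T W n"
proof
  show "shift_space T W (Suc n) \<subseteq> shift_space T W n" by (rule shift_space_decreasing)
  have cW: "csubspace W" using W by (simp add: algebraic_complement_def)
  note sub = csubspace_shift_space[OF T cW]
  show "shift_space T W n \<subseteq> shift_space T W (Suc n)"
  proof
    fix x assume x: "x \<in> shift_space T W n"
    obtain m z where m: "x = m + z" "m \<in> shift_space T W (Suc n)" "(T ^^ n) z = 0"
      using shift_space_plus_ker[OF T W] by blast
    have "x - m \<in> shift_space T W n"
      by (rule complex_vector.subspace_diff[OF sub x]) (rule subsetD[OF shift_space_decreasing m(2)])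
    then have "z \<in> shift_space T W n" using m(1) by simp
    then have "z \<in> range (T ^^ n)" by (rule ker_pow_Int_shift_space[OF T st W _ m(3)])
    then have "z \<in> range (T ^^ Suc n)" by (rule generalized_kernel_deep_range[OF T st m(3)])
    then have "z \<in> shift_space T W (Suc n)" using range_pow_subset_shift_space[OF cW] by blast
    then show "x \<in> shift_space T W (Suc n)"
      unfolding m(1) by (rule complex_vector.subspace_add[OF sub m(2)])
  qed
qed

text \<open>For \<open>V\<close> a complement of the limit \<open>B\<close> of the decreasing chain, these are the \<open>x \<in> ker(T\<^sup>n)\<close> whose
orbit has no component in \<open>B\<close>. The construction is dual to that of the shift space.\<close>

definition avoiding_kernel :: "('a::complex_normed_vector \<Rightarrow> 'a) \<Rightarrow> 'a set \<Rightarrow> nat \<Rightarrow> 'a set" where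
  "avoiding_kernel T V n = {x. (T ^^ n) x = 0 \<and> (\<forall>i. (T ^^ i) x \<in> V)}"

lemma csubspace_avoiding_kernel:
  assumes T: "bounded_clinear T" and V: "csubspace V"
  shows "csubspace (avoiding_kernel T V n)"
  using complex_vector.subspace_0[OF V] complex_vector.subspace_add[OF V] complex_vector.subspace_scale[OF V]
  unfolding complex_vector.subspace_def avoiding_kernel_def
  by (simp add: pow_linear(2,3,4)[OF T])

lemma closed_avoiding_kernel:
  assumes T: "bounded_clinear T" and V: "closed V"
  shows "closed (avoiding_kernel T V n)"
proof -
  have c: "continuous_on UNIV (T ^^ i)" for i
    using pow_linear(1)[OF T] by (rule linear_continuous_on)
  have "avoiding_kernel T V n = {x. (T ^^ n) x = 0} \<inter> (\<Inter>i. (T ^^ i) -` V)"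
    by (auto simp: avoiding_kernel_def)
  moreover have "closed {x. (T ^^ n) x = 0}" by (intro closed_Collect_eq c continuous_on_const)
  moreover have "closed (\<Inter>i. (T ^^ i) -` V)" by (intro closed_INT ballI closed_vimage V c)
  ultimately show ?thesis by (simp add: closed_Int)
qed

lemma avoiding_kernel_invariant:
  assumes T: "bounded_clinear T" shows "T ` avoiding_kernel T V n \<subseteq> avoiding_kernel T V n"
proof (rule image_subsetI)
  fix x assume x: "x \<in> avoiding_kernel T V n"
  have "(T ^^ n) (T x) = 0"
    using x by (simp add: avoiding_kernel_def funpow_swap1[symmetric] bounded_clinearD(3)[OF T])
  moreover have "(T ^^ i) (T x) \<in> V" for i
  proof -
    have "(T ^^ Suc i) x \<in> V" using x unfolding avoiding_kernel_def by blast
    then show ?thesis by (simp add: funpow_swap1)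
  qed
  ultimately show "T x \<in> avoiding_kernel T V n" by (simp add: avoiding_kernel_def)
qed

text \<open>If \<open>x\<close> is in \<open>ran(T\<^sup>n)\<close> and \<open>T\<^bsup>j+1\<^esup> x = 0\<close>, then \<open>T\<^bsup>j\<^esup> x\<close> is in \<open>B \<inter> V\<close>, so \<open>T\<^bsup>j\<^esup> x = 0\<close>; descend
to \<open>j = 0\<close>.\<close>

lemma avoiding_kernel_Int_range:
  assumes T: "bounded_clinear T" and st: "stable_from T n" and V: "ker_cap_ran T n \<inter> V = {0}"
    and x: "x \<in> range (T ^^ n)" "x \<in> avoiding_kernel T V n"
  shows "x = 0"
proof -
  have "x = 0" if "(T ^^ j) x = 0" for j
    using that
  proof (induction j)
    case (Suc j)
    obtain y where y: "x = (T ^^ n) y" using x(1) by blast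
    have "(T ^^ j) x = (T ^^ (j + n)) y" using y by (simp add: pow_add_apply)
    then have "(T ^^ j) x \<in> ker_cap_ran T (j + n)" using Suc.prems unfolding mem_ker_cap_ran by auto
    also have "ker_cap_ran T (j + n) = ker_cap_ran T n" by (rule stable_ker_cap_ran[OF st]) simp
    finally have "(T ^^ j) x \<in> ker_cap_ran T n" .
    moreover have "(T ^^ j) x \<in> V" using x(2) unfolding avoiding_kernel_def by blast
    ultimately have "(T ^^ j) x = 0" using V by blast
    then show ?case by (rule Suc.IH)
  qed simp
  then show ?thesis using x(2) unfolding avoiding_kernel_def by blast
qed

text \<open>The \<open>B\<close>-components of \<open>T\<^bsup>n-1\<^esup> x, \<dots>, T x, x\<close> are removed one after the other by subtracting from \<open>x\<close>
elements of \<open>ran(T\<^sup>n)\<close>. The \<open>B\<close>-component of \<open>T\<^bsup>j\<^esup> x\<close> has the form \<open>T\<^bsup>j+n\<^esup> u\<close> and is killed by \<open>T\<close>, so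
subtracting \<open>T\<^sup>n u\<close> does not affect \<open>T\<^sup>i x\<close> for \<open>i > j\<close>.\<close>

lemma ker_pow_correction:
  assumes T: "bounded_clinear T" and st: "stable_from T n"
    and V: "algebraic_complement UNIV (ker_cap_ran T n) V"
    and "j \<le> n" "(T ^^ n) x = 0" "\<And>i. j \<le> i \<Longrightarrow> (T ^^ i) x \<in> V"
  shows "\<exists>m\<in>range (T ^^ n). x - m \<in> avoiding_kernel T V n"
  using assms(4-)
proof (induction j arbitrary: x)
  case 0
  have "0 \<in> range (T ^^ n)" using pow_linear(3)[OF T, of n] by (metis rangeI)
  moreover have "x - 0 \<in> avoiding_kernel T V n" using 0 by (simp add: avoiding_kernel_def)
  ultimately show ?case by blast
next
  case (Suc j)
  have cV: "csubspace V" using V by (simp add: algebraic_complement_def)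
  have "(T ^^ j) x \<in> ker_cap_ran T n + V" using V by (simp add: algebraic_complement_def)
  then obtain b v where b: "b \<in> ker_cap_ran T n" "v \<in> V" "(T ^^ j) x = b + v" by (rule set_plus_elim)
  have "ker_cap_ran T n = ker_cap_ran T (j + n)" by (rule stable_ker_cap_ran[OF st, symmetric]) simp
  then obtain u where u: "b = (T ^^ (j + n)) u" "T b = 0" using b(1) by (auto simp: mem_ker_cap_ran)
  define m where "m = (T ^^ n) u"
  have mb: "(T ^^ j) m = b" using u by (simp add: m_def pow_add_apply)
  have m0: "(T ^^ Suc j) m = 0" using mb u by simp
  have x1: "(T ^^ n) (x - m) = 0"
    using Suc.prems pow_zero_mono[OF T m0] by (simp add: pow_linear(5)[OF T])
  have "(T ^^ i) (x - m) \<in> V" if "j \<le> i" for i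
  proof (cases "i = j")
    case True
    then show ?thesis using b mb by (simp add: pow_linear(5)[OF T])
  next
    case False
    then have i: "Suc j \<le> i" using that by simp
    then show ?thesis using Suc.prems(3)[OF i] pow_zero_mono[OF T m0 i]
      by (simp add: pow_linear(5)[OF T])
  qed
  then obtain m' where m': "m' \<in> range (T ^^ n)" "x - m - m' \<in> avoiding_kernel T V n"
    using Suc.IH[OF _ x1] Suc.prems(1) by auto
  have "m + m' \<in> range (T ^^ n)"
    by (rule complex_vector.subspace_add[OF csubspace_range[OF bounded_clinear_pow[OF T]] _ m'(1)])
      (simp add: m_def)
  moreover have "x - (m + m') \<in> avoiding_kernel T V n" using m'(2) by (simp add: diff_diff_eq)
  ultimately show ?case by blast
qed

lemma complemented_inI:
  assumes "closed V" "closed W" "algebraic_complement M V W"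
  shows "complemented_in M V"
proof -
  have "0 \<in> V" "0 \<in> W" using assms(3) complex_vector.subspace_0 by (auto simp: algebraic_complement_def)
  then have "V \<subseteq> M" "W \<subseteq> M"
    using assms(3) set_plus_intro[of _ V 0 W] set_plus_intro[of 0 V _ W]
    unfolding algebraic_complement_def by auto
  then show ?thesis unfolding complemented_in_def using assms closed_subset by blast
qed

text \<open>The converse of \<open>Saphar_decomposition_stable\<close> below. The shift space \<open>M\<close> is closed because it is
an operator range with the closed complement \<open>N\<close>. The image of \<open>M\<close> is closed because
it is the intersection of \<open>M\<close> with the limit \<open>A\<close> of the increasing chain, and it has the complement
\<open>W\<close> in \<open>M\<close>; the kernel of the restriction to \<open>M\<close> is the limit \<open>B\<close> of the decreasing chain.\<close>

theorem Saphar_decomposition: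
  fixes T :: "'a::complex_banach \<Rightarrow> 'a"
  assumes T: "bounded_clinear T" and st: "stable_from T n"
    and cA: "complemented_in UNIV (ran_plus_ker T n)" and cB: "complemented_in UNIV (ker_cap_ran T n)"
  shows "saphar_type T"
proof -
  obtain W where A: "closed (ran_plus_ker T n)" and W: "closed W" "algebraic_complement UNIV (ran_plus_ker T n) W"
    using cA unfolding complemented_in_UNIV by blast
  obtain V where B: "closed (ker_cap_ran T n)" and V: "closed V" "algebraic_complement UNIV (ker_cap_ran T n) V"
    using cB unfolding complemented_in_UNIV by blast
  have cW: "csubspace W" and AW: "ran_plus_ker T n \<inter> W = {0}"
    using W by (simp_all add: algebraic_complement_def)
  have cV: "csubspace V" and BV: "ker_cap_ran T n \<inter> V = {0}"
    using V by (simp_all add: algebraic_complement_def)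
  define M where "M = shift_space T W n"
  define N where "N = avoiding_kernel T V n"
  have sM: "csubspace M" unfolding M_def by (rule csubspace_shift_space[OF T cW])
  have sN: "csubspace N" unfolding N_def by (rule csubspace_avoiding_kernel[OF T cV])
  have clN: "closed N" unfolding N_def by (rule closed_avoiding_kernel[OF T V(1)])
  have M_eq: "M = W + T ` M" using shift_space_stationary[OF T st W(2)] by (simp add: M_def)
  have TM: "T ` M \<subseteq> M" using image_shift_space_Suc[OF cW, of T n] shift_space_stationary[OF T st W(2)]
    by (simp add: M_def)
  have TN: "T ` N \<subseteq> N" unfolding N_def by (rule avoiding_kernel_invariant[OF T])
  have rM: "range (T ^^ n) \<subseteq> M" unfolding M_def by (rule range_pow_subset_shift_space[OF cW])
  have MN: "M \<inter> N = {0}"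
  proof -
    have "x = 0" if x: "x \<in> M" "x \<in> N" for x
    proof -
      have "(T ^^ n) x = 0" using x(2) by (simp add: N_def avoiding_kernel_def)
      then have "x \<in> range (T ^^ n)"
        using ker_pow_Int_shift_space[OF T st W(2)] x(1) unfolding M_def by blast
      then show ?thesis using avoiding_kernel_Int_range[OF T st BV] x(2) unfolding N_def by blast
    qed
    then show ?thesis
      using complex_vector.subspace_0[OF sM] complex_vector.subspace_0[OF sN] by blast
  qed
  have sumMN: "M + N = UNIV"
  proof -
    have "x \<in> M + N" for x
    proof -
      obtain m z where m: "x = m + z" "m \<in> M" "(T ^^ n) z = 0"
        using shift_space_plus_ker[OF T W(2), of x n] unfolding M_def by blast
      have "(T ^^ i) z \<in> V" if "n \<le> i" for i
        using pow_zero_mono[OF T m(3) that] complex_vector.subspace_0[OF cV] by simp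
      then obtain y where y: "y \<in> range (T ^^ n)" "z - y \<in> N"
        using ker_pow_correction[OF T st V(2) order_refl m(3)] unfolding N_def by blast
      have "m + y \<in> M" using m(2) y(1) rM sM by (auto intro: complex_vector.subspace_add)
      from set_plus_intro[OF this y(2)] show ?thesis using m(1) by (simp add: algebra_simps)
    qed
    then show ?thesis by blast
  qed
  have clM: "closed M"
  proof (rule closed_operator_range_complement[OF _ csubspace_subspace[OF sM] clN
        csubspace_subspace[OF sN] MN sumMN])
    show "operator_range M" unfolding M_def by (rule operator_range_shift_space[OF T cW W(1)])
  qed
  have red: "(M, N) \<in> Red T"
    using clM clN TM TN sM sN MN sumMN by (simp add: Red_def algebraic_complement_def)
  have ker_eq: "ker_on M T = ker_cap_ran T n"
  proof
    show "ker_on M T \<subseteq> ker_cap_ran T n"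
    proof
      fix x assume "x \<in> ker_on M T"
      then have x: "x \<in> M" "T x = 0" by (auto simp: ker_on_def)
      then have "x \<in> range (T ^^ n)"
        using ker_pow_Int_shift_space[OF T st W(2), of x n 1] unfolding M_def by simp
      then show "x \<in> ker_cap_ran T n" using x by (auto simp: mem_ker_cap_ran)
    qed
    show "ker_cap_ran T n \<subseteq> ker_on M T" using rM by (auto simp: ker_cap_ran_def ker_on_def)
  qed
  have WTM: "W \<inter> T ` M = {0}"
  proof -
    have "T ` M \<subseteq> ran_plus_ker T n"
    proof (rule image_subsetI)
      fix m
      show "T m \<in> ran_plus_ker T n" by (rule apply_in_ran_plus_ker[OF T])
    qed
    then show ?thesis
      using AW complex_vector.subspace_0[OF cW] complex_vector.subspace_0[OF csubspace_image[OF T sM]]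
      by blast
  qed
  \<comment> \<open>By the modular law, because \<open>M = W + T M\<close> and \<open>T M\<close> is contained in \<open>A\<close>, which meets \<open>W\<close> trivially.\<close>
  have TM_eq: "T ` M = ran_plus_ker T n \<inter> M"
  proof
    show "T ` M \<subseteq> ran_plus_ker T n \<inter> M"
    proof (rule image_subsetI)
      fix m assume "m \<in> M"
      moreover have "T m \<in> ran_plus_ker T n" by (rule apply_in_ran_plus_ker[OF T])
      ultimately show "T m \<in> ran_plus_ker T n \<inter> M" using TM by blast
    qed
    show "ran_plus_ker T n \<inter> M \<subseteq> T ` M"
    proof
      fix x assume x: "x \<in> ran_plus_ker T n \<inter> M"
      then have "x \<in> W + T ` M" using M_eq by simp
      then obtain w y where w: "w \<in> W" "y \<in> T ` M" "x = w + y" by (rule set_plus_elim)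
      have "y \<in> ran_plus_ker T n" using w(2) apply_in_ran_plus_ker[OF T] by blast
      then have "x - y \<in> ran_plus_ker T n"
        using x complex_vector.subspace_diff[OF csubspace_ran_plus_ker[OF T]] by blast
      then have "w = 0" using w AW by auto
      then show "x \<in> T ` M" using w by simp
    qed
  qed
  have clTM: "closed (T ` M)" unfolding TM_eq using A clM by (rule closed_Int)
  have "kato_on M T" unfolding kato_on_def
  proof (intro conjI allI)
    show "closedin (top_of_set M) (T ` M)" using TM clTM by (rule closed_subset)
    fix k
    have "ker_on M T = ker_cap_ran T (k + n)" unfolding ker_eq by (rule stable_ker_cap_ran[OF st, symmetric]) simp
    also have "\<dots> \<subseteq> (T ^^ k) ` range (T ^^ n)" by (auto simp: ker_cap_ran_def pow_add_apply image_iff)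
    also have "\<dots> \<subseteq> (T ^^ k) ` M" by (rule image_mono[OF rM])
    finally show "ker_on M T \<subseteq> (T ^^ k) ` M" .
  qed
  moreover have "complemented_in M (ker_on M T)"
  proof (rule complemented_inI)
    show "closed (ker_on M T)" unfolding ker_eq by (rule B)
    show "closed (V \<inter> M)" using V(1) clM by (rule closed_Int)
    show "algebraic_complement M (ker_on M T) (V \<inter> M)" unfolding algebraic_complement_def
    proof (intro conjI)
      show "csubspace (ker_on M T)" unfolding ker_eq by (rule csubspace_ker_cap_ran[OF T])
      show "csubspace (V \<inter> M)" using cV sM by (rule complex_vector.subspace_inter)
      show "ker_on M T \<inter> (V \<inter> M) = {0}"
        using BV complex_vector.subspace_0[OF sM] unfolding ker_eq by blast
      have BM: "ker_cap_ran T n \<subseteq> M" using ker_eq by (auto simp: ker_on_def)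
      show "ker_on M T + (V \<inter> M) = M" unfolding ker_eq
      proof
        show "ker_cap_ran T n + (V \<inter> M) \<subseteq> M"
          using BM sM by (auto elim!: set_plus_elim intro: complex_vector.subspace_add)
        show "M \<subseteq> ker_cap_ran T n + (V \<inter> M)"
        proof
          fix x assume x: "x \<in> M"
          have "x \<in> ker_cap_ran T n + V" using V(2) by (simp add: algebraic_complement_def)
          then obtain b v where b: "b \<in> ker_cap_ran T n" "v \<in> V" "x = b + v" by (rule set_plus_elim)
          have "x - b \<in> M" using x b(1) BM sM by (auto intro: complex_vector.subspace_diff)
          then have "v \<in> V \<inter> M" using b by simp
          with b(1) show "x \<in> ker_cap_ran T n + (V \<inter> M)" unfolding b(3) by (rule set_plus_intro)
        qed
      qed
    qed
  qed
  moreover have "complemented_in M (T ` M)"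
  proof (rule complemented_inI[OF clTM W(1)])
    show "algebraic_complement M (T ` M) W"
      using csubspace_image[OF T sM] cW WTM M_eq
      by (simp add: algebraic_complement_def Int_commute add.commute)
  qed
  ultimately have "saphar_on M T" by (simp add: saphar_on_def relatively_regular_on_def)
  moreover have "nilpotent_on N T"
    unfolding nilpotent_on_def N_def avoiding_kernel_def by blast
  ultimately show ?thesis using red unfolding saphar_type_def by blast
qed

section \<open>Stability of Saphar decompositions\<close>

lemma algebraic_complement_sym: "algebraic_complement X V W \<Longrightarrow> algebraic_complement X W V"
  by (simp add: algebraic_complement_def Int_commute add.commute)

text \<open>The sum \<open>U + N\<close> is the preimage of \<open>U\<close> under the projection onto \<open>M\<close> along \<open>N\<close>.\<close>

lemma complement_lift:
  fixes M N :: "'a::complex_banach set"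
  assumes M: "closed M" and N: "closed N" and MN: "algebraic_complement UNIV M N"
    and U: "closed U" and UW: "algebraic_complement M U W"
  shows "closed (U + N)" and "algebraic_complement UNIV (U + N) W"
proof -
  obtain P where P: "bounded_clinear P" "\<And>x. P x \<in> M" "\<And>x. x - P x \<in> N"
    "\<And>x. x \<in> M \<Longrightarrow> P x = x" "\<And>x. x \<in> N \<Longrightarrow> P x = 0"
    using complementary_projection[OF M N MN] by metis
  have sub: "csubspace U" "csubspace W" "csubspace M" "csubspace N"
    and UW0: "U \<inter> W = {0}" and UWM: "U + W = M"
    using UW MN by (simp_all add: algebraic_complement_def)
  have UM: "U \<subseteq> M"
    using UWM set_plus_intro[of _ U 0 W] complex_vector.subspace_0[OF sub(2)] by fastforce
  have WM: "W \<subseteq> M"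
    using UWM set_plus_intro[of 0 U _ W] complex_vector.subspace_0[OF sub(1)] by fastforce
  have eq: "U + N = P -` U"
  proof
    show "U + N \<subseteq> P -` U"
    proof
      fix x assume "x \<in> U + N"
      then obtain u n where "u \<in> U" "n \<in> N" "x = u + n" by (rule set_plus_elim)
      then show "x \<in> P -` U" using P(4)[of u] P(5)[of n] UM by (auto simp: bounded_clinearD(4)[OF P(1)])
    qed
    show "P -` U \<subseteq> U + N"
    proof
      fix x assume "x \<in> P -` U"
      then have "P x \<in> U" by simp
      from set_plus_intro[OF this P(3)[of x]] show "x \<in> U + N" by simp
    qed
  qed
  show "closed (U + N)" unfolding eq
    by (intro closed_vimage U linear_continuous_on bounded_clinearD(1)[OF P(1)])
  show "algebraic_complement UNIV (U + N) W" unfolding algebraic_complement_def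
  proof (intro conjI)
    show "csubspace (U + N)" "csubspace W" using sub by (simp_all add: csubspace_plus)
    have "x = 0" if x: "x \<in> U + N" "x \<in> W" for x
    proof -
      have "P x \<in> U" using x(1) unfolding eq by simp
      moreover have "P x = x" using x(2) WM P(4) by blast
      ultimately show ?thesis using x(2) UW0 by auto
    qed
    then show "(U + N) \<inter> W = {0}"
      using complex_vector.subspace_0[OF sub(2)] complex_vector.subspace_0[OF csubspace_plus[OF sub(1,4)]]
      by blast
    have "U + N + W = (U + W) + N" by (simp add: add_ac)
    then show "U + N + W = UNIV" using UWM MN by (simp add: algebraic_complement_def)
  qed
qed

text \<open>The Kato condition passes from the kernel to the kernels of all powers: if \<open>T x = T\<^bsup>j+1\<^esup> y\<close> by
induction, then \<open>x - T\<^bsup>j\<^esup> y\<close> is in the kernel, hence in the range of \<open>T\<^bsup>j\<^esup>\<close>.\<close>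

lemma Kato_kernel_pow_subset_range:
  assumes T: "bounded_clinear T" and sM: "csubspace M" and TM: "T ` M \<subseteq> M"
    and kato: "kato_on M T" and "x \<in> M" "(T ^^ k) x = 0"
  shows "x \<in> (T ^^ j) ` M"
  using assms(5,6)
proof (induction k arbitrary: x j)
  case 0
  then have "x = (T ^^ j) 0" by (simp add: pow_linear(3)[OF T])
  then show ?case using complex_vector.subspace_0[OF sM] by (rule image_eqI)
next
  case (Suc k)
  have "T x \<in> M" "(T ^^ k) (T x) = 0" using Suc.prems TM by (auto simp: funpow_swap1)
  then have "T x \<in> (T ^^ Suc j) ` M" by (rule Suc.IH)
  then obtain y where y: "y \<in> M" "T x = (T ^^ Suc j) y" by blast
  have jM: "(T ^^ j) y \<in> M" using y(1) TM by (induction j) auto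
  have "T (x - (T ^^ j) y) = 0" using y by (simp add: bounded_clinearD(5)[OF T])
  moreover have "x - (T ^^ j) y \<in> M" using Suc.prems(1) jM by (rule complex_vector.subspace_diff[OF sM])
  ultimately have "x - (T ^^ j) y \<in> (T ^^ j) ` M" using kato unfolding kato_on_def ker_on_def by blast
  moreover have "(T ^^ j) y \<in> (T ^^ j) ` M" using y(1) by (rule imageI)
  ultimately have "x - (T ^^ j) y + (T ^^ j) y \<in> (T ^^ j) ` M"
    by (rule complex_vector.subspace_add[OF csubspace_image[OF bounded_clinear_pow[OF T] sM]])
  then show ?case by simp
qed

text \<open>From the index \<open>k\<close> on the chains are those of the restriction to \<open>M\<close>: the intersection of kernel
and range is the kernel of the restriction, and \<open>ran(T) + ker(T\<^bsup>k\<^esup>)\<close> is its range plus \<open>N\<close>.\<close>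

lemma Saphar_decomposition_stable:
  fixes T :: "'a::complex_banach \<Rightarrow> 'a"
  assumes T: "bounded_clinear T" and red: "(M, N) \<in> Red T" and saph: "saphar_on M T"
    and nil: "\<And>x. x \<in> N \<Longrightarrow> (T ^^ k) x = 0"
  shows "stable_from T k" and "complemented_in UNIV (ran_plus_ker T k)" and "complemented_in UNIV (ker_cap_ran T k)"
proof -
  have cl: "closed M" "closed N" and TM: "T ` M \<subseteq> M" and TN: "T ` N \<subseteq> N"
    and MN: "algebraic_complement UNIV M N"
    using red by (auto simp: Red_def)
  have sub: "csubspace M" "csubspace N" and sum: "M + N = UNIV"
    using MN by (simp_all add: algebraic_complement_def)
  have kato: "kato_on M T" and ck: "complemented_in M (ker_on M T)" and cr: "complemented_in M (T ` M)"
    using saph by (simp_all add: saphar_on_def relatively_regular_on_def)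
  have powM: "(T ^^ j) x \<in> M" if "x \<in> M" for j x
    using that TM by (induction j) auto
  have ker_cap_ran_eq: "ker_cap_ran T m = ker_on M T" if m: "k \<le> m" for m
  proof
    show "ker_cap_ran T m \<subseteq> ker_on M T"
    proof
      fix x assume "x \<in> ker_cap_ran T m"
      then obtain y where y: "T x = 0" "x = (T ^^ m) y" by (auto simp: mem_ker_cap_ran)
      have "y \<in> M + N" using sum by simp
      then obtain a b where ab: "a \<in> M" "b \<in> N" "y = a + b" by (rule set_plus_elim)
      have "(T ^^ m) b = 0" by (rule pow_zero_mono[OF T nil[OF ab(2)] m])
      then have "x = (T ^^ m) a" using y ab by (simp add: pow_linear(4)[OF T])
      then show "x \<in> ker_on M T" using y powM[OF ab(1)] by (simp add: ker_on_def)
    qed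
    have "ker_on M T \<subseteq> (T ^^ m) ` M" using kato by (simp add: kato_on_def)
    then show "ker_on M T \<subseteq> ker_cap_ran T m" by (auto simp: ker_cap_ran_def ker_on_def)
  qed
  show "stable_from T k"
    unfolding stable_from_def using ker_cap_ran_eq by (metis order_refl)
  have ran_plus_ker_eq: "ran_plus_ker T k = T ` M + N"
  proof
    show "ran_plus_ker T k \<subseteq> T ` M + N"
    proof
      fix x assume "x \<in> ran_plus_ker T k"
      then obtain y z where yz: "x = T y + z" "(T ^^ k) z = 0" by (auto simp: mem_ran_plus_ker)
      have "y \<in> M + N" using sum by simp
      then obtain a b where ab: "a \<in> M" "b \<in> N" "y = a + b" by (rule set_plus_elim)
      have "z \<in> M + N" using sum by simp
      then obtain c d where cd: "c \<in> M" "d \<in> N" "z = c + d" by (rule set_plus_elim)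
      have "(T ^^ k) c = 0" using yz(2) nil[OF cd(2)] cd(3) by (simp add: pow_linear(4)[OF T])
      then have "c \<in> (T ^^ 1) ` M" by (rule Kato_kernel_pow_subset_range[OF T sub(1) TM kato cd(1)])
      then have "c \<in> T ` M" by simp
      then have 1: "T a + c \<in> T ` M"
        using ab(1) by (intro complex_vector.subspace_add[OF csubspace_image[OF T sub(1)]]) auto
      have 2: "T b + d \<in> N"
        using ab(2) cd(2) TN by (intro complex_vector.subspace_add[OF sub(2)]) auto
      have "x = (T a + c) + (T b + d)" using yz ab cd by (simp add: bounded_clinearD(4)[OF T])
      then show "x \<in> T ` M + N" using set_plus_intro[OF 1 2] by simp
    qed
    have "T ` M \<subseteq> range T" "N \<subseteq> ker (T ^^ k)" using nil by (auto simp: ker_on_def)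
    then show "T ` M + N \<subseteq> ran_plus_ker T k" unfolding ran_plus_ker_def by (rule set_plus_mono2)
  qed
  show "complemented_in UNIV (ran_plus_ker T k)"
  proof -
    obtain W where W: "closedin (top_of_set M) (T ` M)" "closedin (top_of_set M) W"
      "algebraic_complement M (T ` M) W"
      using cr by (auto simp: complemented_in_def)
    have "closed (T ` M)" "closed W" using W(1,2) cl(1) by (auto intro: closedin_closed_trans)
    then show ?thesis
      unfolding ran_plus_ker_eq using complement_lift[OF cl MN _ W(3)] complemented_inI by blast
  qed
  show "complemented_in UNIV (ker_cap_ran T k)"
  proof -
    obtain V where V: "closedin (top_of_set M) (ker_on M T)" "closedin (top_of_set M) V"
      "algebraic_complement M (ker_on M T) V"
      using ck by (auto simp: complemented_in_def)
    have "closed (ker_on M T)" "closed V" using V(1,2) cl(1) by (auto intro: closedin_closed_trans)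
    then show ?thesis
      unfolding ker_cap_ran_eq[OF order_refl]
      using complement_lift[OF cl MN _ algebraic_complement_sym[OF V(3)]]
        complemented_inI algebraic_complement_sym by blast
  qed
qed

lemma saphar_type_iff:
  fixes T :: "'a::complex_banach \<Rightarrow> 'a"
  assumes T: "bounded_clinear T"
  shows "saphar_type T \<longleftrightarrow>
    (\<exists>n. stable_from T n \<and> complemented_in UNIV (ran_plus_ker T n) \<and> complemented_in UNIV (ker_cap_ran T n))"
proof
  assume "saphar_type T"
  then obtain M N where MN: "(M, N) \<in> Red T" "saphar_on M T" "nilpotent_on N T"
    by (auto simp: saphar_type_def)
  then obtain k where "\<And>x. x \<in> N \<Longrightarrow> (T ^^ k) x = 0" by (auto simp: nilpotent_on_def)
  from Saphar_decomposition_stable[OF T MN(1,2) this]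
  show "\<exists>n. stable_from T n \<and> complemented_in UNIV (ran_plus_ker T n) \<and> complemented_in UNIV (ker_cap_ran T n)"
    by blast
qed (use Saphar_decomposition[OF T] in blast)

section \<open>The five classes\<close>

text \<open>The condition that the class with number \<open>i\<close> imposes on the limits of the increasing chain, \<open>A\<close>,
and of the decreasing chain, \<open>B\<close>.\<close>

definition stage_condition ::
    "nat \<Rightarrow> 'a::complex_normed_vector set \<Rightarrow> 'a set \<Rightarrow> bool" where
  "stage_condition i A B \<longleftrightarrow>
     (if i = 1 then complemented_in UNIV A \<and> complemented_in UNIV B
      else if i = 2 then B = {0} \<and> complemented_in UNIV A
      else if i = 3 then A = UNIV \<and> complemented_in UNIV B
      else if i = 4 then finite_cdim B \<and> complemented_in UNIV A
      else i = 5 \<and> finite_ccodim A \<and> complemented_in UNIV B)"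

lemma S_class_iff:
  fixes T :: "'a::complex_banach \<Rightarrow> 'a"
  assumes T: "bounded_clinear T"
  shows "T \<in> S_class i \<longleftrightarrow> (\<exists>n. stable_from T n \<and> stage_condition i (ran_plus_ker T n) (ker_cap_ran T n))"
  using T unfolding S_class_def stage_condition_def saphar_type_iff[OF T, symmetric]
  by (simp add: saphar_type_iff[OF T] left_drazin_iff[OF T] right_drazin_iff[OF T]
      ess_left_drazin_iff[OF T] ess_right_drazin_iff[OF T])

text \<open>For \<open>i = 5\<close> the point is that \<open>ran(T) + ker(T\<^sup>n)\<close> is closed: it is an operator range and has an
algebraic complement of finite dimension, which is closed.\<close>

lemma stage_condition_complemented:
  fixes T :: "'a::complex_banach \<Rightarrow> 'a"
  assumes T: "bounded_clinear T" and c: "stage_condition i (ran_plus_ker T n) (ker_cap_ran T n)"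
  shows "complemented_in UNIV (ran_plus_ker T n)" and "complemented_in UNIV (ker_cap_ran T n)"
proof -
  have "finite_cdim {0::'a}" unfolding finite_cdim_def by (intro exI[of _ "{}"]) simp
  then have fin: "finite_cdim (ker_cap_ran T n) \<Longrightarrow> complemented_in UNIV (ker_cap_ran T n)"
    and zero: "complemented_in UNIV {0::'a}"
    by (simp_all add: finite_cdim_complemented csubspace_ker_cap_ran[OF T] complex_vector.subspace_single_0)
  have cofin: "complemented_in UNIV (ran_plus_ker T n)" if fc: "finite_ccodim (ran_plus_ker T n)"
  proof -
    obtain W where W: "algebraic_complement UNIV (ran_plus_ker T n) W" "finite_cdim W"
      using fc by (auto simp: finite_ccodim_def)
    then have sW: "csubspace W" by (simp add: algebraic_complement_def)
    have clW: "closed W" using finite_cdim_complemented[OF sW W(2)] by (simp add: complemented_in_UNIV)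
    have "closed (ker (T ^^ n))" unfolding ker_on_def
      using linear_continuous_on[OF pow_linear(1)[OF T], of UNIV n]
      by (simp add: closed_Collect_eq continuous_on_const)
    then have "operator_range (ker (T ^^ n))"
      by (intro operator_range_closed_subspace csubspace_subspace csubspace_ker bounded_clinear_pow T)
    moreover have "operator_range (range T)"
      by (intro operator_range_image bounded_clinearD(1)[OF T] operator_range_closed_subspace) auto
    ultimately have "operator_range (ran_plus_ker T n)" unfolding ran_plus_ker_def by (intro operator_range_plus)
    then have "closed (ran_plus_ker T n)"
      using W(1) closed_operator_range_complement[OF _ csubspace_subspace[OF csubspace_ran_plus_ker[OF T]] clW
          csubspace_subspace[OF sW]]
      by (simp add: algebraic_complement_def)
    then show ?thesis using clW W(1) by (rule complemented_inI)
  qed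
  have "complemented_in UNIV (UNIV :: 'a set)"
  proof (rule complemented_inI)
    show "algebraic_complement UNIV (UNIV :: 'a set) {0}"
      by (simp add: algebraic_complement_def complex_vector.subspace_UNIV complex_vector.subspace_single_0)
  qed auto
  then show "complemented_in UNIV (ran_plus_ker T n)" "complemented_in UNIV (ker_cap_ran T n)"
    using c fin zero cofin unfolding stage_condition_def by (auto split: if_splits)
qed

lemma pow_orthogonal_sum:
  assumes S: "bounded_clinear S" and R: "bounded_clinear R" and T: "T = (\<lambda>x. S x + R x)"
    and SR: "\<And>x. S (R x) = 0" and RS: "\<And>x. R (S x) = 0"
  shows "(T ^^ Suc m) x = (S ^^ Suc m) x + (R ^^ Suc m) x"
proof (induction m)
  case 0
  then show ?case by (simp add: T)
next
  case (Suc m)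
  have "(T ^^ Suc (Suc m)) x = S ((T ^^ Suc m) x) + R ((T ^^ Suc m) x)" by (simp add: T)
  also have "\<dots> = (S ^^ Suc (Suc m)) x + (R ^^ Suc (Suc m)) x"
    unfolding Suc by (simp add: bounded_clinearD(4)[OF S] bounded_clinearD(4)[OF R] SR RS)
  finally show ?case .
qed

text \<open>On \<open>ran(T\<^sup>m) = ran(S\<^sup>m)\<close> the operators \<open>S\<close> and \<open>T\<close> agree because \<open>R S = 0\<close>. The ranges of \<open>S\<close> and \<open>T\<close>
differ by elements \<open>R y\<close>, which are in \<open>ker(S\<^sup>m)\<close> because \<open>S R = 0\<close>. The index has to be positive:
\<open>T\<^sup>m = S\<^sup>m + R\<^sup>m\<close> fails for \<open>m = 0\<close>.\<close>

lemma nilpotent_perturbation_stages: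
  assumes S: "bounded_clinear S" and R: "bounded_clinear R" and T: "T = (\<lambda>x. S x + R x)"
    and SR: "\<And>x. S (R x) = 0" and RS: "\<And>x. R (S x) = 0"
    and nil: "\<And>x. (R ^^ k) x = 0" and m: "Suc k \<le> m"
  shows "ran_plus_ker T m = ran_plus_ker S m" and "ker_cap_ran T m = ker_cap_ran S m"
proof -
  obtain j where j: "m = Suc j" using m by (cases m) auto
  have "(R ^^ m) x = 0" for x using pow_zero_mono[OF R nil] m by simp
  then have pow: "(T ^^ m) x = (S ^^ m) x" for x
    using pow_orthogonal_sum[OF S R T SR RS, of j x] unfolding j by simp
  have "R ((S ^^ m) x) = 0" for x unfolding j by (simp add: RS)
  then have "T ((S ^^ m) x) = S ((S ^^ m) x)" for x by (simp add: T)
  then show "ker_cap_ran T m = ker_cap_ran S m" by (auto simp: mem_ker_cap_ran set_eq_iff pow)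
  have SmR: "(S ^^ m) (R x) = 0" for x
    unfolding j funpow_Suc_right by (simp add: SR pow_linear(3)[OF S])
  show "ran_plus_ker T m = ran_plus_ker S m"
  proof (intro set_eqI iffI)
    fix x assume "x \<in> ran_plus_ker T m"
    then obtain y z where yz: "x = T y + z" "(T ^^ m) z = 0" by (auto simp: mem_ran_plus_ker)
    have "x = S y + (R y + z)" using yz(1) by (simp add: T add.assoc)
    moreover have "(S ^^ m) (R y + z) = 0" using yz(2) by (simp add: pow pow_linear(4)[OF S] SmR)
    ultimately show "x \<in> ran_plus_ker S m" unfolding mem_ran_plus_ker by blast
  next
    fix x assume "x \<in> ran_plus_ker S m"
    then obtain y z where yz: "x = S y + z" "(S ^^ m) z = 0" by (auto simp: mem_ran_plus_ker)
    have "x = T y + (z - R y)" using yz(1) by (simp add: T)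
    moreover have "(T ^^ m) (z - R y) = 0" using yz(2) by (simp add: pow pow_linear(5)[OF S] SmR)
    ultimately show "x \<in> ran_plus_ker T m" unfolding mem_ran_plus_ker by blast
  qed
qed

lemma S_class_depends_on_late_stages:
  fixes S T :: "'a::complex_banach \<Rightarrow> 'a"
  assumes S: "bounded_clinear S" and T: "bounded_clinear T"
    and eq: "\<And>m. k \<le> m \<Longrightarrow> ran_plus_ker T m = ran_plus_ker S m" "\<And>m. k \<le> m \<Longrightarrow> ker_cap_ran T m = ker_cap_ran S m"
    and mem: "S \<in> S_class i"
  shows "T \<in> S_class i"
proof -
  obtain n where n: "stable_from S n" "stage_condition i (ran_plus_ker S n) (ker_cap_ran S n)"
    using mem S_class_iff[OF S] by blast
  let ?m = "max n k"
  have late_ker_cap_ran: "ker_cap_ran T m = ker_cap_ran S n" if "?m \<le> m" for m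
    using eq(2)[of m] stable_ker_cap_ran[OF n(1), of m] that by simp
  have "ran_plus_ker T ?m = ran_plus_ker S n" using eq(1)[of ?m] stable_ran_plus_ker[OF S n(1), of ?m] by simp
  moreover have "ker_cap_ran T ?m = ker_cap_ran S n" by (rule late_ker_cap_ran) simp
  ultimately have "stage_condition i (ran_plus_ker T ?m) (ker_cap_ran T ?m)" using n(2) by simp
  moreover have "stable_from T ?m"
    unfolding stable_from_def using late_ker_cap_ran order_refl by metis
  ultimately show ?thesis using S_class_iff[OF T] by blast
qed

lemma S_class_nilpotent_perturbation:
  fixes S R T :: "'a::complex_banach \<Rightarrow> 'a"
  assumes S: "bounded_clinear S" and R: "bounded_clinear R" and bT: "bounded_clinear T"
    and T: "T = (\<lambda>x. S x + R x)"
    and SR: "S \<circ> R = (\<lambda>_. 0)" and RS: "R \<circ> S = (\<lambda>_. 0)" and nil: "nilpotent R"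
  shows "T \<in> S_class i \<longleftrightarrow> S \<in> S_class i"
proof -
  obtain k where k: "\<And>x. (R ^^ k) x = 0" using nil by (auto simp: nilpotent_on_def)
  have SR': "S (R x) = 0" and RS': "R (S x) = 0" for x
    using fun_cong[OF SR, of x] fun_cong[OF RS, of x] by simp_all
  note stages = nilpotent_perturbation_stages[OF S R T SR' RS' k]
  show ?thesis
  proof
    assume mem: "T \<in> S_class i"
    show "S \<in> S_class i"
      by (rule S_class_depends_on_late_stages[OF bT S _ _ mem, of "Suc k"]) (simp_all add: stages)
  next
    assume mem: "S \<in> S_class i"
    show "T \<in> S_class i"
      by (rule S_class_depends_on_late_stages[OF S bT _ _ mem, of "Suc k"]) (simp_all add: stages)
  qed
qed

lemma S1_class_subset_S_class: "S1_class i \<subseteq> S_class i"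
  unfolding S1_class_def S_class_def saphar_type_def saphar_type_of_degree_def by auto

lemma Inf_enat_le_1: "1 \<in> A \<Longrightarrow> Inf (enat ` A) \<le> 1"
  using Inf_lower[of "enat 1" "enat ` A"] by (simp add: one_enat_def)

text \<open>The limits of the chains are attained at the index 1, and the bound on each of the four numbers
says that the corresponding condition on \<open>A\<close> or \<open>B\<close> holds at that index.\<close>

lemma S1_class_of_stable_1:
  fixes S :: "'a::complex_banach \<Rightarrow> 'a"
  assumes S: "bounded_clinear S" and st: "stable_from S 1" and mem: "S \<in> S_class i" and i: "i \<noteq> 1"
  shows "S \<in> S1_class i"
proof -
  obtain n where n: "stable_from S n" "stage_condition i (ran_plus_ker S n) (ker_cap_ran S n)"
    using mem S_class_iff[OF S] by blast
  have c: "stage_condition i (ran_plus_ker S 1) (ker_cap_ran S 1)"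
    using n(2) unfolding stable_unique[OF S n(1) st] .
  have "ascent S \<le> 1" if "i = 2"
    using c that unfolding ascent_def ascent_condition[OF S]
    by (intro Inf_enat_le_1) (simp add: stage_condition_def)
  moreover have "descent S \<le> 1" if "i = 3"
    using c that unfolding descent_def descent_condition[OF S]
    by (intro Inf_enat_le_1) (simp add: stage_condition_def)
  moreover have "ess_ascent S \<le> 1" if "i = 4"
    using c that unfolding ess_ascent_def ker_cap_ran_def[symmetric]
    by (intro Inf_enat_le_1) (simp add: stage_condition_def)
  moreover have "ess_descent S \<le> 1" if "i = 5"
    using c that unfolding ess_descent_def ran_plus_ker_def[symmetric]
    by (intro Inf_enat_le_1) (simp add: stage_condition_def)
  ultimately show ?thesis using mem i by (auto simp: S_class_def S1_class_def split: if_splits)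
qed

lemma saphar_on_cong:
  assumes TM: "T ` M \<subseteq> M" and eq: "\<And>x. x \<in> M \<Longrightarrow> S x = T x"
  shows "saphar_on M S \<longleftrightarrow> saphar_on M T"
proof -
  have pow: "(S ^^ n) x = (T ^^ n) x \<and> (T ^^ n) x \<in> M" if "x \<in> M" for n x
    using that TM eq by (induction n) auto
  have "(S ^^ n) ` M = (T ^^ n) ` M" for n using pow by (intro image_cong) auto
  moreover have "S ` M = T ` M" using eq by (intro image_cong) auto
  moreover have "ker_on M S = ker_on M T" using eq by (auto simp: ker_on_def)
  ultimately show ?thesis
    by (simp add: saphar_on_def kato_on_def relatively_regular_on_def)
qed

text \<open>With respect to the decomposition \<open>X = M \<oplus> N\<close>, the operator \<open>S\<close> is \<open>T\<close> on \<open>M\<close> and zero on \<open>N\<close>, and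
\<open>R\<close> is zero on \<open>M\<close> and \<open>T\<close> on \<open>N\<close>.\<close>

lemma S_class_splitting:
  fixes T :: "'a::complex_banach \<Rightarrow> 'a"
  assumes T: "bounded_clinear T" and mem: "T \<in> S_class i"
  obtains S R where "bounded_clinear S" "bounded_clinear R" "T = (\<lambda>x. S x + R x)"
    "S \<circ> R = (\<lambda>_. 0)" "R \<circ> S = (\<lambda>_. 0)" "S \<in> S1_class i" "nilpotent R"
proof -
  obtain n where n: "stable_from T n" "stage_condition i (ran_plus_ker T n) (ker_cap_ran T n)"
    using mem S_class_iff[OF T] by blast
  have "saphar_type T"
    by (rule Saphar_decomposition[OF T n(1) stage_condition_complemented[OF T n(2)]])
  then obtain M N k where red: "(M, N) \<in> Red T" and saph: "saphar_on M T"
    and nil: "\<And>x. x \<in> N \<Longrightarrow> (T ^^ k) x = 0"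
    by (auto simp: saphar_type_def nilpotent_on_def)
  have cl: "closed M" "closed N" and TM: "\<And>x. x \<in> M \<Longrightarrow> T x \<in> M" and TN: "\<And>x. x \<in> N \<Longrightarrow> T x \<in> N"
    and MN: "algebraic_complement UNIV M N"
    using red by (auto simp: Red_def)
  have N0: "0 \<in> N" using MN complex_vector.subspace_0 by (auto simp: algebraic_complement_def)
  obtain P where P: "bounded_clinear P" "\<And>x. P x \<in> M" "\<And>x. x - P x \<in> N"
    "\<And>x. x \<in> M \<Longrightarrow> P x = x" "\<And>x. x \<in> N \<Longrightarrow> P x = 0"
    using complementary_projection[OF cl MN] by metis
  define S where "S = (\<lambda>x. T (P x))"
  define R where "R = (\<lambda>x. T (x - P x))"
  note TD = bounded_clinearD[OF T] and PD = bounded_clinearD[OF P(1)]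
  have bS: "bounded_clinear S" unfolding bounded_clinear_def S_def
    using bounded_linear_compose[OF TD(1) PD(1)] by (simp add: TD(2) PD(2))
  have bR: "bounded_clinear R" unfolding bounded_clinear_def R_def
    using bounded_linear_compose[OF TD(1) bounded_linear_sub[OF bounded_linear_ident PD(1)]]
    by (simp add: TD(2) PD(2) flip: complex_vector.scale_right_diff_distrib)
  have sum: "T = (\<lambda>x. S x + R x)" by (simp add: S_def R_def flip: TD(4))
  have SR: "S \<circ> R = (\<lambda>_. 0)" by (auto simp: S_def R_def P(3,5) TN TD(3))
  have RS: "R \<circ> S = (\<lambda>_. 0)" by (auto simp: S_def R_def P(2,4) TM TD(3))
  have "(R ^^ Suc j) x = (T ^^ Suc j) (x - P x) \<and> (T ^^ Suc j) (x - P x) \<in> N" for j x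
  proof (induction j)
    case 0
    then show ?case by (simp add: R_def P(3) TN)
  next
    case (Suc j)
    have "R y = T y" if "y \<in> N" for y using that by (simp add: R_def P(5))
    then show ?case using Suc TN by simp
  qed
  then have "(R ^^ Suc k) x = 0" for x using nil[OF P(3)] by (simp add: TD(3))
  then have nR: "nilpotent R" unfolding nilpotent_on_def by blast
  have SM: "S x = T x" if "x \<in> M" for x using that by (simp add: S_def P(4))
  have SN: "S x = 0" if "x \<in> N" for x using that by (simp add: S_def P(5) TD(3))
  have redS: "(M, N) \<in> Red S" using cl MN TM SM SN N0 by (auto simp: Red_def)
  have saphS: "saphar_on M S" using saph saphar_on_cong[of T M S] SM TM by blast
  have mS: "S \<in> S_class i"
    using mem S_class_nilpotent_perturbation[OF bS bR T sum SR RS nR] by simp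
  have "S \<in> S1_class i"
  proof (cases "i = 1")
    case True
    have z: "\<forall>x\<in>N. (S ^^ 1) x = 0" by (simp add: SN)
    then have "nilpotency_degree_on N S \<le> 1" unfolding nilpotency_degree_on_def by (rule Least_le)
    moreover have "nilpotent_on N S" unfolding nilpotent_on_def using z by blast
    ultimately have "\<exists>d\<le>1. saphar_type_of_degree d S"
      using redS saphS unfolding saphar_type_of_degree_def by blast
    then show ?thesis using True bS by (simp add: S1_class_def)
  next
    case False
    \<comment> \<open>\<open>S\<close> vanishes on \<open>N\<close>, so its restriction to \<open>N\<close> is nilpotent with exponent 1.\<close>
    have "stable_from S 1"
      by (rule Saphar_decomposition_stable(1)[OF bS redS saphS]) (simp add: SN)
    then show ?thesis using S1_class_of_stable_1[OF bS _ mS False] by blast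
  qed
  with that bS bR sum SR RS nR show ?thesis by blast
qed

theorem theorem3p12:
  fixes T :: "'a::complex_banach \<Rightarrow> 'a" and i :: nat
  assumes "\<not> finite_cdim (UNIV :: 'a set)"
    and "bounded_clinear T"
    and "i \<in> {1, 2, 3, 4, 5}"
  shows "(T \<in> S_class i \<longleftrightarrow>
           (\<exists>S R. bounded_clinear S \<and> bounded_clinear R \<and> T = (\<lambda>x. S x + R x) \<and>
              S \<circ> R = (\<lambda>_. 0) \<and> R \<circ> S = (\<lambda>_. 0) \<and> S \<in> S1_class i \<and> nilpotent R))
       \<and> (T \<in> S_class i \<longleftrightarrow>
           (\<exists>S R. bounded_clinear S \<and> bounded_clinear R \<and> T = (\<lambda>x. S x + R x) \<and>
              S \<circ> R = (\<lambda>_. 0) \<and> R \<circ> S = (\<lambda>_. 0) \<and> S \<in> S_class i \<and> nilpotent R))"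
    (is "(?i \<longleftrightarrow> ?ii) \<and> (?i \<longleftrightarrow> ?iii)")
proof -
  have "?i \<Longrightarrow> ?ii" by (rule S_class_splitting[OF assms(2)]) blast+
  moreover have "?ii \<Longrightarrow> ?iii" using S1_class_subset_S_class[of i] by blast
  moreover have "?iii \<Longrightarrow> ?i" using S_class_nilpotent_perturbation[OF _ _ assms(2)] by blast
  ultimately show ?thesis by blast
qed

end
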